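(* Let $\gamma\in\mathbb{R}_+\setminus\mathbb{N}$, $1<p,q<\infty$, let $\mathcal{D}^\gamma_{p,q}$ be the Besov space of modelled distributions for the polynomial regularity structure on $\mathbb{R}^d$ with its polynomial model, and let $\mathcal{R}\colon\mathcal{D}^\gamma_{p,q}\to\mathcal{B}^\gamma_{p,q}$ be the reconstruction operator (a continuous linear isomorphism). Let $W=(W^1,\dots,W^n)$ be an $\mathbb{R}^n$-valued Brownian motion on $[0,T]$ on a complete filtered probability space. (1) Let $-A$ be the infinitesimal generator of a $C_0$-semigroup $S(t)$ on $\mathcal{B}^\gamma_{p,q}$, let $F,G_1,\dots,G_n\colon\mathcal{B}^\gamma_{p,q}\to\mathcal{B}^\gamma_{p,q}$ be measurable and $x_0\in\mathcal{B}^\gamma_{p,q}$. If $(X_t)_{t\in[0,T]}$ is a càdlàg mild solution to the semilinear SPDE on $\mathcal{B}^\gamma_{p,q}$ $$\mathrm{d}X_t=(-AX_t+F(X_t))\,\mathrm{d}t+\sum_{i=1}^nG_i(X_t)\,\mathrm{d}W^i_t,\qquad X_0=x_0,$$ then $Y_t:=\mathcal{R}^{-1}(X_t)$, $t\in[0,T]$, is a càdlàg mild solution to the semilinear SPDE on $\mathcal{D}^\gamma_{p,q}$ $$\mathrm{d}Y_t=(-\tilde AY_t+\tilde F(Y_t))\,\mathrm{d}t+\sum_{i=1}^n\tilde G_i(Y_t)\,\mathrm{d}W^i_t,\qquad Y_0=\mathcal{R}^{-1}x_0,$$ where $-\tilde A:=\mathcal{R}^{-1}\circ(-A)\circ\mathcal{R}$,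 $\tilde F:=\mathcal{R}^{-1}\circ F\circ\mathcal{R}$ and $\tilde G_i:=\mathcal{R}^{-1}\circ G_i\circ\mathcal{R}$. (2) Conversely, let $-\tilde A$ be the infinitesimal generator of a $C_0$-semigroup $T(t)$ on $\mathcal{D}^\gamma_{p,q}$, let $\tilde F,\tilde G_1,\dots,\tilde G_n\colon\mathcal{D}^\gamma_{p,q}\to\mathcal{D}^\gamma_{p,q}$ be measurable and $Y_0\in\mathcal{D}^\gamma_{p,q}$. If $(Y_t)_{t\in[0,T]}$ is a càdlàg mild solution on $\mathcal{D}^\gamma_{p,q}$ to $\mathrm{d}Y_t=(-\tilde AY_t+\tilde F(Y_t))\,\mathrm{d}t+\sum_{i=1}^n\tilde G_i(Y_t)\,\mathrm{d}W^i_t$ with initial value $Y_0$, then $X_t:=\mathcal{R}(Y_t)$, $t\in[0,T]$, is a càdlàg mild solution on $\mathcal{B}^\gamma_{p,q}$ to $\mathrm{d}X_t=(-AX_t+F(X_t))\,\mathrm{d}t+\sum_{i=1}^nG_i(X_t)\,\mathrm{d}W^i_t$ with $-A=\mathcal{R}\circ(-\tilde A)\circ\mathcal{R}^{-1}$, $F=\mathcal{R}\circ\tilde F\circ\mathcal{R}^{-1}$, $G_i=\mathcal{R}\circ\tilde G_i\circ\mathcal{R}^{-1}$ and $X_0=\mathcal{R}(Y_0)$.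
   Context: **Mild solution.** Let $E$ be a UMD Banach space (here $E=\mathcal{B}^\gamma_{p,q}$ or $E=\mathcal{D}^\gamma_{p,q}$, both UMD), $-A$ the generator of a $C_0$-semigroup $S(t)$ of bounded linear operators on $E$, $F,G_i\colon E\to E$ measurable. An adapted $E$-valued process $(X_t)_{t\in[0,T]}$ with almost surely càdlàg paths is a *càdlàg mild solution* of $\mathrm{d}X_t=(-AX_t+F(X_t))\mathrm{d}t+\sum_iG_i(X_t)\mathrm{d}W^i_t$ with initial value $X_0$ if (all integrals being well defined) $$X_t=S(t)X_0+\int_0^tS(t-s)F(X_s)\,\mathrm{d}s+\sum_{i=1}^n\int_0^tS(t-s)G_i(X_s)\,\mathrm{d}W^i_s,\qquad t\in[0,T],$$ with stochastic integrals in the sense of stochastic integration in UMD Banach spaces (van Neerven–Veraar–Weis). The operator $\mathcal{R}^{-1}\circ(-A)\circ\mathcal{R}$ has domain $\mathcal{R}^{-1}(D(A))$ and generates the $C_0$-semigroup $\mathcal{R}^{-1}\circ S(t)\circ\mathcal{R}$ (and analogously for the converse conjugation). **Test functions.** $B(0,1)$ is the unit ball for $\|x\|:=\sup_i|x_i|$. $\mathcal{B}^r$: compactly supported $\phi\in\mathcal{C}^r(\mathbb{R}^d)$ with $\|\phi\|_{\mathcal{C}^r}\le1$ and support in $B(0,1)$; $\mathcal{B}^r_m$: those $\phi\in\mathcal{B}^r$ annihilating all polynomials of degree at most $m$. $\eta^\lambda_x(y):=\lambda^{-d}\eta(\lambda^{-1}(y-x))$; $L^q_\lambda:=L^q((0,1),\lambda^{-1}\mathrm{d}\lambda)$.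 **Classical Besov space.** For $\gamma>0$ and an integer $r>\gamma$, $\mathcal{B}^\gamma_{p,q}=\mathcal{B}^\gamma_{p,q}(\mathbb{R}^d)$ is the space of distributions $\xi$ with $\|\sup_{\eta\in\mathcal{B}^r}|\langle\xi,\eta^1_x\rangle|\|_{L^p(\mathrm{d}x)}<\infty$ and $\big\|\,\|\sup_{\eta\in\mathcal{B}^r_{\lfloor\gamma\rfloor}}|\langle\xi,\eta^\lambda_x\rangle|/\lambda^\gamma\|_{L^p(\mathrm{d}x)}\big\|_{L^q_\lambda}<\infty$ (the usual Besov space). **Polynomial regularity structure and model.** $A=\mathbb{N}$; $T=\mathbb{R}[X_1,\dots,X_d]=\bigoplus_{m\in\mathbb{N}}T_m$, $T_m=\mathrm{span}\{X^k:|k|=m\}$, $X^k=X_1^{k_1}\cdots X_d^{k_d}$; $G\simeq(\mathbb{R}^d,+)$ acts by $\Gamma_hP(X)=P(X+h)$. The model is $\Pi_xP(X)=P(\cdot-x)$, $\Gamma_{x,y}P(X)=P(X+(x-y))$. (The index set $A$, model space $T$ and operator symbols are unrelated to the generator $-A$ and the time horizon/semigroup $T$.) **Modelled distributions.** $\mathcal{D}^\gamma_{p,q}$ is the space of measurable $f\colon\mathbb{R}^d\to\bigoplus_{m<\gamma}T_m$ with $$|||f|||_{\gamma,p,q}:=\sum_{m<\gamma}\big\||f(x)|_m\big\|_{L^p(\mathrm{d}x)}+\sum_{m<\gamma}\bigg(\int_{B(0,1)}\Big\|\frac{|f(x+h)-\Gamma_{x+h,x}f(x)|_m}{\|h\|^{\gamma-m}}\Big\|_{L^p(\mathrm{d}x)}^q\frac{\mathrm{d}h}{\|h\|^d}\bigg)^{1/q}<\infty,$$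 where $|\cdot|_m$ is the norm of the component in $T_m$. **Reconstruction operator.** $\mathcal{R}$ is the unique continuous linear operator on $\mathcal{D}^\gamma_{p,q}$ with $\big\|\,\|\sup_{\eta\in\mathcal{B}^r}|\langle\mathcal{R}f-\Pi_xf(x),\eta^\lambda_x\rangle|/\lambda^\gamma\|_{L^p(\mathrm{d}x)}\big\|_{L^q_\lambda}\lesssim|||f|||_{\gamma,p,q}$; it is known to be a continuous isomorphism from $\mathcal{D}^\gamma_{p,q}$ onto $\mathcal{B}^\gamma_{p,q}$. *)

theory Defs
  imports "HOL-Probability.Probability" "HOL-Analysis.Finite_Function_Topology" "HOL-Library.Function_Algebras"
begin

text \<open>
  The Besov spaces below depend on the real parameters \<open>\<gamma>, p, q\<close>, so they are not types.
  A normed space is therefore a pair \<open>(V, N)\<close> of a carrier \<open>V\<close> in a real vector space and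
  a function \<open>N\<close> that is its norm on \<open>V\<close>; nothing is claimed about \<open>N\<close> outside \<open>V\<close>.
\<close>

instantiation "fun" :: (type, real_vector) real_vector
begin
definition "scaleR c f = (\<lambda>x. c *\<^sub>R f x)"
instance
  by standard (auto simp: scaleR_fun_def fun_eq_iff scaleR_add_right scaleR_add_left)
end


section \<open>Test functions and distributions\<close>

definition partial :: "'d::finite \<Rightarrow> (real^'d \<Rightarrow> real) \<Rightarrow> real^'d \<Rightarrow> real" where
  "partial i \<phi> x = frechet_derivative \<phi> (at x) (axis i 1)"

definition partials :: "'d::finite list \<Rightarrow> (real^'d \<Rightarrow> real) \<Rightarrow> real^'d \<Rightarrow> real" where
  "partials is \<phi> = foldr partial is \<phi>"

definition Cr :: "nat \<Rightarrow> (real^'d::finite \<Rightarrow> real) set" where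
  "Cr r = {\<phi>. (\<forall>is x. length is < r \<longrightarrow> partials is \<phi> differentiable at x) \<and>
              (\<forall>is. length is \<le> r \<longrightarrow> continuous_on UNIV (partials is \<phi>))}"

definition Cr_norm :: "nat \<Rightarrow> (real^'d::finite \<Rightarrow> real) \<Rightarrow> ennreal" where
  "Cr_norm r \<phi> = (SUP is\<in>{is. length is \<le> r}. SUP x. ennreal \<bar>partials is \<phi> x\<bar>)"

definition supp :: "(real^'d::finite \<Rightarrow> real) \<Rightarrow> (real^'d) set" where
  "supp \<phi> = closure {x. \<phi> x \<noteq> 0}"

definition Cr_c :: "nat \<Rightarrow> (real^'d::finite \<Rightarrow> real) set" where
  "Cr_c r = {\<phi> \<in> Cr r. compact (supp \<phi>)}"

text \<open>\<open>infnorm\<close> is the norm \<open>sup\<^sub>i |x\<^sub>i|\<close>.\<close>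

definition unit_ball :: "(real^'d::finite) set" where
  "unit_ball = {x. infnorm x < 1}"

definition test_functions :: "nat \<Rightarrow> (real^'d::finite \<Rightarrow> real) set" where
  "test_functions r = {\<phi> \<in> Cr_c r. Cr_norm r \<phi> \<le> 1 \<and> supp \<phi> \<subseteq> unit_ball}"

definition rescale :: "real \<Rightarrow> real^'d::finite \<Rightarrow> (real^'d \<Rightarrow> real) \<Rightarrow> real^'d \<Rightarrow> real" where
  "rescale l x \<eta> = (\<lambda>y. \<eta> ((1 / l) *\<^sub>R (y - x)) / l ^ CARD('d))"

text \<open>
  Distributions are paired with test functions that are only of class \<open>C\<^sup>r\<close>, so they are taken in
  the dual of \<open>C\<^sup>r\<^sub>c\<close>. They are extended by \<open>0\<close> outside \<open>C\<^sup>r\<^sub>c\<close>, so that equal distributions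
  are equal as HOL functions.
\<close>

type_synonym 'd functional = "(real^'d \<Rightarrow> real) \<Rightarrow> real"

definition distributions :: "nat \<Rightarrow> 'd::finite functional set" where
  "distributions r = {\<xi>.
     (\<forall>\<phi>\<in>Cr_c r. \<forall>\<psi>\<in>Cr_c r. \<forall>a b. \<xi> (\<lambda>x. a * \<phi> x + b * \<psi> x) = a * \<xi> \<phi> + b * \<xi> \<psi>) \<and>
     (\<forall>K. compact K \<longrightarrow> (\<exists>C::real. \<forall>\<phi>\<in>Cr_c r. supp \<phi> \<subseteq> K \<longrightarrow>
        ennreal \<bar>\<xi> \<phi>\<bar> \<le> ennreal C * Cr_norm r \<phi>)) \<and>
     (\<forall>\<phi>. \<phi> \<notin> Cr_c r \<longrightarrow> \<xi> \<phi> = 0)}"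


section \<open>Polynomials\<close>

text \<open>\<open>\<real>[X\<^sub>1,\<dots>,X\<^sub>d]\<close> as the monoid algebra over the multi-indices \<open>nat^'d\<close>.\<close>

type_synonym 'd mpoly = "(nat^'d) \<Rightarrow>\<^sub>0 real"

definition mdeg :: "nat^'d::finite \<Rightarrow> nat" where
  "mdeg k = (\<Sum>i\<in>UNIV. k $ i)"

definition mvar :: "'d::finite \<Rightarrow> 'd mpoly" where
  "mvar i = Poly_Mapping.single (axis i 1) 1"

definition mconst :: "real \<Rightarrow> 'd::finite mpoly" where
  "mconst c = Poly_Mapping.single 0 c"

definition mpoly_eval :: "'d::finite mpoly \<Rightarrow> real^'d \<Rightarrow> real" where
  "mpoly_eval P y = (\<Sum>k\<in>Poly_Mapping.keys P. Poly_Mapping.lookup P k * (\<Prod>i\<in>UNIV. (y $ i) ^ (k $ i)))"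

text \<open>\<open>mpoly_shift h P = P(X + h)\<close>\<close>

definition mpoly_shift :: "real^'d::finite \<Rightarrow> 'd mpoly \<Rightarrow> 'd mpoly" where
  "mpoly_shift h P = (\<Sum>k\<in>Poly_Mapping.keys P. mconst (Poly_Mapping.lookup P k) * (\<Prod>i\<in>UNIV. (mvar i + mconst (h $ i)) ^ (k $ i)))"

text \<open>The Euclidean norm of the coefficients of the component in \<open>T\<^sub>m\<close>.\<close>

definition comp_norm :: "nat \<Rightarrow> 'd::finite mpoly \<Rightarrow> real" where
  "comp_norm m P = L2_set (Poly_Mapping.lookup P) {k. mdeg k = m}"

definition below :: "real \<Rightarrow> 'd::finite mpoly set" where
  "below \<gamma> = {P. \<forall>k\<in>Poly_Mapping.keys P. real (mdeg k) < \<gamma>}"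

definition Gam :: "real^'d::finite \<Rightarrow> real^'d \<Rightarrow> 'd mpoly \<Rightarrow> 'd mpoly" where
  "Gam x y = mpoly_shift (x - y)"

definition Pi_model :: "real^'d::finite \<Rightarrow> 'd mpoly \<Rightarrow> 'd functional" where
  "Pi_model x P = (\<lambda>\<phi>. \<integral>y. mpoly_eval P (y - x) * \<phi> y \<partial>lborel)"

definition annihilating_test_functions :: "nat \<Rightarrow> nat \<Rightarrow> (real^'d::finite \<Rightarrow> real) set" where
  "annihilating_test_functions r m = {\<phi> \<in> test_functions r.
     \<forall>P. (\<forall>k\<in>Poly_Mapping.keys P. mdeg k \<le> m) \<longrightarrow> (\<integral>y. mpoly_eval P y * \<phi> y \<partial>lborel) = 0}"


section \<open>Besov spaces\<close>

definition ennpowr :: "ennreal \<Rightarrow> real \<Rightarrow> ennreal" where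
  "ennpowr a s = (if a = \<infinity> then \<infinity> else ennreal (enn2real a powr s))"

definition Lp_norm :: "real \<Rightarrow> 'a measure \<Rightarrow> ('a \<Rightarrow> ennreal) \<Rightarrow> ennreal" where
  "Lp_norm p M u = ennpowr (\<integral>\<^sup>+x. ennpowr (u x) p \<partial>M) (1 / p)"

text \<open>The measures \<open>\<lambda>\<^sup>-\<^sup>1 d\<lambda>\<close> on \<open>(0,1)\<close> and \<open>\<parallel>h\<parallel>\<^sup>-\<^sup>d dh\<close> on \<open>B(0,1)\<close>.\<close>

definition scale_measure_01 :: "real measure" where
  "scale_measure_01 = density lborel (\<lambda>l. indicator {0<..<1} l * ennreal (1 / l))"

definition shift_measure :: "(real^'d::finite) measure" where
  "shift_measure = density lborel (\<lambda>h. indicator unit_ball h * ennreal (1 / infnorm h ^ CARD('d)))"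

definition besov_enorm :: "real \<Rightarrow> real \<Rightarrow> real \<Rightarrow> nat \<Rightarrow> 'd::finite functional \<Rightarrow> ennreal" where
  "besov_enorm \<gamma> p q r \<xi> =
     Lp_norm p lborel (\<lambda>x. SUP \<eta>\<in>test_functions r. ennreal \<bar>\<xi> (rescale 1 x \<eta>)\<bar>) +
     Lp_norm q scale_measure_01 (\<lambda>l. Lp_norm p lborel (\<lambda>x.
       SUP \<eta>\<in>annihilating_test_functions r (nat \<lfloor>\<gamma>\<rfloor>). ennreal (\<bar>\<xi> (rescale l x \<eta>)\<bar> / l powr \<gamma>)))"

definition besov :: "real \<Rightarrow> real \<Rightarrow> real \<Rightarrow> nat \<Rightarrow> 'd::finite functional set" where
  "besov \<gamma> p q r = {\<xi> \<in> distributions r. besov_enorm \<gamma> p q r \<xi> < \<infinity>}"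

definition besov_norm :: "real \<Rightarrow> real \<Rightarrow> real \<Rightarrow> nat \<Rightarrow> 'd::finite functional \<Rightarrow> real" where
  "besov_norm \<gamma> p q r \<xi> = enn2real (besov_enorm \<gamma> p q r \<xi>)"


section \<open>Modelled distributions\<close>

text \<open>As usual for spaces of \<open>L\<^sup>p\<close> type, functions that agree almost everywhere are identified.\<close>

quotient_type (overloaded) 'd mfun = "real^'d::finite \<Rightarrow> 'd mpoly" /
  "\<lambda>f g. AE x in lborel. f x = g x"
  by (rule equivpI) (auto simp: reflp_def symp_def transp_def eq_commute elim: eventually_elim2)

instantiation mfun :: (finite) real_vector
begin
lift_definition zero_mfun :: "'a mfun" is "\<lambda>x. 0" .
lift_definition plus_mfun :: "'a mfun \<Rightarrow> 'a mfun \<Rightarrow> 'a mfun" is "\<lambda>f g x. f x + g x"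
  by (auto elim: eventually_elim2)
lift_definition minus_mfun :: "'a mfun \<Rightarrow> 'a mfun \<Rightarrow> 'a mfun" is "\<lambda>f g x. f x - g x"
  by (auto elim: eventually_elim2)
lift_definition uminus_mfun :: "'a mfun \<Rightarrow> 'a mfun" is "\<lambda>f x. - f x"
  by (auto elim: eventually_mono)
lift_definition scaleR_mfun :: "real \<Rightarrow> 'a mfun \<Rightarrow> 'a mfun" is "\<lambda>c f x. c *\<^sub>R f x"
  by (auto elim: eventually_mono)
instance
  by standard (transfer; simp add: algebra_simps)+
end

definition mfun_enorm_raw ::
  "real \<Rightarrow> real \<Rightarrow> real \<Rightarrow> (real^'d::finite \<Rightarrow> 'd mpoly) \<Rightarrow> ennreal" where
  "mfun_enorm_raw \<gamma> p q f =
     (\<Sum>m | real m < \<gamma>. Lp_norm p lborel (\<lambda>x. ennreal (comp_norm m (f x)))) +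
     (\<Sum>m | real m < \<gamma>. Lp_norm q shift_measure (\<lambda>h. Lp_norm p lborel (\<lambda>x.
        ennreal (comp_norm m (f (x + h) - Gam (x + h) x (f x)) / infnorm h powr (\<gamma> - real m)))))"

lemma AE_lborel_translate:
  fixes h :: "'a::euclidean_space"
  assumes "AE x in lborel. P x"
  shows "AE x in lborel. P (x + h)"
proof -
  obtain N where N: "N \<in> null_sets lborel" "{x. \<not> P x} \<subseteq> N"
    using assms by (auto simp: eventually_ae_filter)
  have ds: "distr lborel borel (\<lambda>x. x + h) = lborel"
    using lborel_distr_plus[of h] by (simp add: add.commute[of _ h])
  have "AE x in distr lborel borel (\<lambda>x. x + h). x \<notin> N"
    unfolding ds using N(1) by (rule AE_not_in)
  then have "AE x in lborel. x + h \<notin> N"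
    using N(1) by (subst (asm) AE_distr_iff) auto
  then show ?thesis
    by (rule eventually_mono) (use N(2) in auto)
qed

lemma Lp_norm_cong_AE:
  "(AE x in M. u x = v x) \<Longrightarrow> Lp_norm p M u = Lp_norm p M v"
  unfolding Lp_norm_def by (rule arg_cong2[where f = ennpowr, OF nn_integral_cong_AE refl])
    (auto elim: eventually_mono)

lift_definition mfun_enorm :: "real \<Rightarrow> real \<Rightarrow> real \<Rightarrow> 'd::finite mfun \<Rightarrow> ennreal"
  is mfun_enorm_raw
proof -
  fix \<gamma> p q and f g :: "real^'d \<Rightarrow> 'd mpoly"
  assume fg: "AE x in lborel. f x = g x"
  have ae: "AE x in lborel. f x = g x \<and> f (x + h) = g (x + h)" for h
    using fg AE_lborel_translate[OF fg, of h] by auto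
  have "Lp_norm p lborel (\<lambda>x. ennreal (comp_norm m (f (x + h) - Gam (x + h) x (f x)) / c)) =
      Lp_norm p lborel (\<lambda>x. ennreal (comp_norm m (g (x + h) - Gam (x + h) x (g x)) / c))" for m h c
    by (intro Lp_norm_cong_AE eventually_mono[OF ae[of h]]) auto
  moreover have "Lp_norm p lborel (\<lambda>x. ennreal (comp_norm m (f x))) =
      Lp_norm p lborel (\<lambda>x. ennreal (comp_norm m (g x)))" for m
    using fg by (intro Lp_norm_cong_AE) (auto elim: eventually_mono)
  ultimately show "mfun_enorm_raw \<gamma> p q f = mfun_enorm_raw \<gamma> p q g"
    by (simp add: mfun_enorm_raw_def)
qed

text \<open>
  A class belongs to the space if it has a Borel measurable representative with values in
  \<open>\<Oplus>\<^bsub>m<\<gamma>\<^esub> T\<^sub>m\<close>.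
\<close>

definition modelled :: "real \<Rightarrow> real \<Rightarrow> real \<Rightarrow> 'd::finite mfun set" where
  "modelled \<gamma> p q = {abs_mfun f | f.
     (\<forall>k. (\<lambda>x. Poly_Mapping.lookup (f x) k) \<in> borel_measurable borel) \<and>
     (\<forall>x. f x \<in> below \<gamma>) \<and> mfun_enorm_raw \<gamma> p q f < \<infinity>}"

definition modelled_norm :: "real \<Rightarrow> real \<Rightarrow> real \<Rightarrow> 'd::finite mfun \<Rightarrow> real" where
  "modelled_norm \<gamma> p q f = enn2real (mfun_enorm \<gamma> p q f)"


section \<open>The reconstruction operator\<close>

definition bounded_linear_map ::
  "'a::real_vector set \<Rightarrow> ('a \<Rightarrow> real) \<Rightarrow> 'b::real_vector set \<Rightarrow> ('b \<Rightarrow> real) \<Rightarrow> ('a \<Rightarrow> 'b) \<Rightarrow> bool" where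
  "bounded_linear_map V N V' N' L \<longleftrightarrow>
     (\<forall>x\<in>V. L x \<in> V') \<and>
     (\<forall>x\<in>V. \<forall>y\<in>V. \<forall>a b. L (a *\<^sub>R x + b *\<^sub>R y) = a *\<^sub>R L x + b *\<^sub>R L y) \<and>
     (\<exists>C. \<forall>x\<in>V. N' (L x) \<le> C * N x)"

definition bounded_linear_iso ::
  "'a::real_vector set \<Rightarrow> ('a \<Rightarrow> real) \<Rightarrow> 'b::real_vector set \<Rightarrow> ('b \<Rightarrow> real) \<Rightarrow> ('a \<Rightarrow> 'b) \<Rightarrow> bool" where
  "bounded_linear_iso V N V' N' L \<longleftrightarrow>
     bij_betw L V V' \<and> bounded_linear_map V N V' N' L \<and>
     bounded_linear_map V' N' V N (the_inv_into V L)"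

definition recon_error_raw ::
  "real \<Rightarrow> real \<Rightarrow> real \<Rightarrow> nat \<Rightarrow> 'd functional \<Rightarrow> (real^'d::finite \<Rightarrow> 'd mpoly) \<Rightarrow> ennreal" where
  "recon_error_raw \<gamma> p q r \<xi> f = Lp_norm q scale_measure_01 (\<lambda>l. Lp_norm p lborel (\<lambda>x.
     SUP \<eta>\<in>test_functions r.
       ennreal (\<bar>\<xi> (rescale l x \<eta>) - Pi_model x (f x) (rescale l x \<eta>)\<bar> / l powr \<gamma>)))"

lift_definition recon_error ::
  "real \<Rightarrow> real \<Rightarrow> real \<Rightarrow> nat \<Rightarrow> 'd functional \<Rightarrow> 'd::finite mfun \<Rightarrow> ennreal"
  is recon_error_raw
  unfolding recon_error_raw_def
  by (intro arg_cong[where f = "Lp_norm _ scale_measure_01"] ext Lp_norm_cong_AE)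
    (auto elim: eventually_mono)

definition is_reconstruction ::
  "real \<Rightarrow> real \<Rightarrow> real \<Rightarrow> nat \<Rightarrow> ('d::finite mfun \<Rightarrow> 'd functional) \<Rightarrow> bool" where
  "is_reconstruction \<gamma> p q r R \<longleftrightarrow>
     bounded_linear_map (modelled \<gamma> p q) (modelled_norm \<gamma> p q)
       (besov \<gamma> p q r) (besov_norm \<gamma> p q r) R \<and>
     (\<exists>C::real. \<forall>f\<in>modelled \<gamma> p q.
        recon_error \<gamma> p q r (R f) f \<le> ennreal (C * modelled_norm \<gamma> p q f))"


section \<open>Semigroups\<close>

definition C0_semigroup ::
  "'e::real_vector set \<Rightarrow> ('e \<Rightarrow> real) \<Rightarrow> (real \<Rightarrow> 'e \<Rightarrow> 'e) \<Rightarrow> bool" where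
  "C0_semigroup V N S \<longleftrightarrow>
     (\<forall>t\<ge>0. bounded_linear_map V N V N (S t)) \<and>
     (\<forall>x\<in>V. S 0 x = x) \<and>
     (\<forall>s\<ge>0. \<forall>t\<ge>0. \<forall>x\<in>V. S (s + t) x = S s (S t x)) \<and>
     (\<forall>x\<in>V. ((\<lambda>h. N (S h x - x)) \<longlongrightarrow> 0) (at_right 0))"

text \<open>\<open>L\<close> with domain \<open>D\<close> is the infinitesimal generator of \<open>S\<close>.\<close>

definition generator ::
  "'e::real_vector set \<Rightarrow> ('e \<Rightarrow> real) \<Rightarrow> (real \<Rightarrow> 'e \<Rightarrow> 'e) \<Rightarrow> 'e set \<Rightarrow> ('e \<Rightarrow> 'e) \<Rightarrow> bool" where
  "generator V N S D L \<longleftrightarrow>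
     D = {x \<in> V. \<exists>y\<in>V. ((\<lambda>h. N ((1 / h) *\<^sub>R (S h x - x) - y)) \<longlongrightarrow> 0) (at_right 0)} \<and>
     (\<forall>x\<in>D. L x \<in> V \<and> ((\<lambda>h. N ((1 / h) *\<^sub>R (S h x - x) - L x)) \<longlongrightarrow> 0) (at_right 0))"


section \<open>Integration in normed spaces\<close>

definition borel_on :: "'e::real_vector set \<Rightarrow> ('e \<Rightarrow> real) \<Rightarrow> 'e measure" where
  "borel_on V N = sigma V {U. U \<subseteq> V \<and> (\<forall>x\<in>U. \<exists>\<epsilon>>0. \<forall>y\<in>V. N (y - x) < \<epsilon> \<longrightarrow> y \<in> U)}"

text \<open>
  The library predicate \<open>has_bochner_integral\<close>, with the norm of the type replaced by \<open>N\<close>.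
\<close>

definition has_bochner_integral_on ::
  "'e::real_vector set \<Rightarrow> ('e \<Rightarrow> real) \<Rightarrow> 'a measure \<Rightarrow> ('a \<Rightarrow> 'e) \<Rightarrow> 'e \<Rightarrow> bool" where
  "has_bochner_integral_on V N M f x \<longleftrightarrow>
     f \<in> measurable M (borel_on V N) \<and> x \<in> V \<and>
     (\<exists>s :: nat \<Rightarrow> 'a \<Rightarrow> 'e.
        (\<forall>i. Bochner_Integration.simple_bochner_integrable M (s i) \<and> s i \<in> space M \<rightarrow> V) \<and>
        (\<lambda>i. \<integral>\<^sup>+y. ennreal (N (f y - s i y)) \<partial>M) \<longlonglongrightarrow> 0 \<and>
        (\<lambda>i. N (Bochner_Integration.simple_bochner_integral M (s i) - x)) \<longlonglongrightarrow> 0)"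

definition complete_filtered_prob_space ::
  "'w measure \<Rightarrow> real \<Rightarrow> (real \<Rightarrow> 'w measure) \<Rightarrow> bool" where
  "complete_filtered_prob_space M T Filt \<longleftrightarrow>
     prob_space M \<and> complete_measure M \<and>
     (\<forall>t\<in>{0..T}. subalgebra M (Filt t) \<and> null_sets M \<subseteq> sets (Filt t)) \<and>
     (\<forall>s\<in>{0..T}. \<forall>t\<in>{0..T}. s \<le> t \<longrightarrow> sets (Filt s) \<subseteq> sets (Filt t))"

definition brownian_motion ::
  "'w measure \<Rightarrow> real \<Rightarrow> (real \<Rightarrow> 'w measure) \<Rightarrow> (real \<Rightarrow> 'w \<Rightarrow> real^'n::finite) \<Rightarrow> bool" where
  "brownian_motion M T Filt W \<longleftrightarrow>
     (\<forall>t\<in>{0..T}. W t \<in> borel_measurable (Filt t)) \<and>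
     (AE \<omega> in M. W 0 \<omega> = 0) \<and>
     (AE \<omega> in M. continuous_on {0..T} (\<lambda>t. W t \<omega>)) \<and>
     (\<forall>s t. 0 \<le> s \<and> s < t \<and> t \<le> T \<longrightarrow>
        prob_space.indep_set M (sets (Filt s))
          {(\<lambda>\<omega>. W t \<omega> - W s \<omega>) -` B \<inter> space M | B. B \<in> sets borel} \<and>
        distributed M lborel (\<lambda>\<omega>. W t \<omega> - W s \<omega>)
          (\<lambda>x. ennreal (\<Prod>i\<in>UNIV. normal_density 0 (sqrt (t - s)) (x $ i))))"

text \<open>
  The adapted elementary process \<open>\<Sum>\<^bsub>j<m\<^esub> 1\<^bsub>(\<tau>\<^sub>j, \<tau>\<^sub>j\<^sub>+\<^sub>1]\<^esub> \<xi>\<^sub>j\<close> on \<open>[0,t]\<close> and its integral up to time \<open>u\<close>.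
\<close>

definition elementary ::
  "'e set \<Rightarrow> 'w measure \<Rightarrow> (real \<Rightarrow> 'w measure) \<Rightarrow> real \<Rightarrow>
   nat \<Rightarrow> (nat \<Rightarrow> real) \<Rightarrow> (nat \<Rightarrow> 'w \<Rightarrow> 'e) \<Rightarrow> bool" where
  "elementary V M Filt t m \<tau> \<xi> \<longleftrightarrow>
     (\<forall>j\<le>m. \<tau> j \<in> {0..t}) \<and> (\<forall>j<m. \<tau> j \<le> \<tau> (Suc j)) \<and>
     (\<forall>j<m. simple_function (Filt (\<tau> j)) (\<xi> j) \<and> \<xi> j \<in> space M \<rightarrow> V)"

definition elem_process ::
  "nat \<Rightarrow> (nat \<Rightarrow> real) \<Rightarrow> (nat \<Rightarrow> 'w \<Rightarrow> 'e::real_vector) \<Rightarrow> real \<Rightarrow> 'w \<Rightarrow> 'e" where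
  "elem_process m \<tau> \<xi> s \<omega> = (\<Sum>j<m. indicator {\<tau> j<..\<tau> (Suc j)} s *\<^sub>R \<xi> j \<omega>)"

definition elem_integral ::
  "(real \<Rightarrow> 'w \<Rightarrow> real) \<Rightarrow> nat \<Rightarrow> (nat \<Rightarrow> real) \<Rightarrow> (nat \<Rightarrow> 'w \<Rightarrow> 'e::real_vector) \<Rightarrow> real \<Rightarrow> 'w \<Rightarrow> 'e" where
  "elem_integral w m \<tau> \<xi> u \<omega> =
     (\<Sum>j<m. (w (min u (\<tau> (Suc j))) \<omega> - w (min u (\<tau> j)) \<omega>) *\<^sub>R \<xi> j \<omega>)"

text \<open>
  Stochastic integration in the sense of van Neerven--Veraar--Weis: \<open>\<Phi>\<close> is stochastically
  integrable on \<open>[0,t]\<close> with integral process \<open>Z\<close> if adapted elementary processes \<open>\<Phi>\<^sub>n\<close> converge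
  to \<open>\<Phi>\<close> in measure on \<open>[0,t] \<times> \<Omega>\<close> and their integrals converge to \<open>Z\<close> in probability, uniformly
  on \<open>[0,t]\<close>. The outer measure only avoids the junk value \<open>0\<close> that \<open>emeasure\<close> takes on
  non-measurable sets; on measurable sets it is the measure.
\<close>

definition has_stochastic_integral ::
  "'e::real_vector set \<Rightarrow> ('e \<Rightarrow> real) \<Rightarrow> 'w measure \<Rightarrow> (real \<Rightarrow> 'w measure) \<Rightarrow> (real \<Rightarrow> 'w \<Rightarrow> real) \<Rightarrow>
   real \<Rightarrow> (real \<Rightarrow> 'w \<Rightarrow> 'e) \<Rightarrow> (real \<Rightarrow> 'w \<Rightarrow> 'e) \<Rightarrow> bool" where
  "has_stochastic_integral V N M Filt w t \<Phi> Z \<longleftrightarrow>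
     (\<lambda>(s, \<omega>). \<Phi> s \<omega>) \<in> measurable (completion (restrict_space lborel {0..t} \<Otimes>\<^sub>M M)) (borel_on V N) \<and>
     (\<forall>s\<in>{0..t}. \<Phi> s \<in> measurable (Filt s) (borel_on V N)) \<and>
     (\<forall>u\<in>{0..t}. Z u \<in> measurable M (borel_on V N)) \<and>
     (AE \<omega> in M. \<forall>u\<in>{0..t}. ((\<lambda>v. N (Z v \<omega> - Z u \<omega>)) \<longlongrightarrow> 0) (at u within {0..t})) \<and>
     (\<exists>m \<tau> \<xi>.
        (\<forall>n. elementary V M Filt t (m n) (\<tau> n) (\<xi> n)) \<and>
        (\<forall>\<epsilon>>0. (\<lambda>n. outer_measure_of (restrict_space lborel {0..t} \<Otimes>\<^sub>M M)
           {(s, \<omega>). s \<in> {0..t} \<and> \<omega> \<in> space M \<and>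
              N (elem_process (m n) (\<tau> n) (\<xi> n) s \<omega> - \<Phi> s \<omega>) > \<epsilon>}) \<longlonglongrightarrow> 0) \<and>
        (\<forall>\<epsilon>>0. (\<lambda>n. outer_measure_of M
           {\<omega> \<in> space M. \<exists>u\<in>{0..t}.
              N (elem_integral w (m n) (\<tau> n) (\<xi> n) u \<omega> - Z u \<omega>) > \<epsilon>}) \<longlonglongrightarrow> 0))"


section \<open>Mild solutions\<close>

text \<open>
  The data of \<open>dX = (L X + F(X)) dt + \<Sum>\<^sub>i G\<^sub>i(X) dW\<^sup>i\<close>, \<open>X\<^sub>0 = x\<^sub>0\<close>. The operator \<open>L\<close>, with domain
  \<open>D\<close>, is the generator itself, i.e. \<open>-A\<close>.
\<close>

definition spde_data ::
  "'e::real_vector set \<Rightarrow> ('e \<Rightarrow> real) \<Rightarrow> (real \<Rightarrow> 'e \<Rightarrow> 'e) \<Rightarrow> 'e set \<Rightarrow> ('e \<Rightarrow> 'e) \<Rightarrow>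
   ('e \<Rightarrow> 'e) \<Rightarrow> ('n \<Rightarrow> 'e \<Rightarrow> 'e) \<Rightarrow> 'e \<Rightarrow> bool" where
  "spde_data V N S D L F G x0 \<longleftrightarrow>
     C0_semigroup V N S \<and> generator V N S D L \<and>
     F \<in> measurable (borel_on V N) (borel_on V N) \<and>
     (\<forall>i. G i \<in> measurable (borel_on V N) (borel_on V N)) \<and> x0 \<in> V"

definition cadlag_on ::
  "'e::real_vector set \<Rightarrow> ('e \<Rightarrow> real) \<Rightarrow> real \<Rightarrow> (real \<Rightarrow> 'e) \<Rightarrow> bool" where
  "cadlag_on V N T x \<longleftrightarrow>
     (\<forall>t\<in>{0..<T}. ((\<lambda>s. N (x s - x t)) \<longlongrightarrow> 0) (at_right t)) \<and>
     (\<forall>t\<in>{0<..T}. \<exists>l\<in>V. ((\<lambda>s. N (x s - l)) \<longlongrightarrow> 0) (at_left t))"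

definition cadlag_mild_solution ::
  "'e::real_vector set \<Rightarrow> ('e \<Rightarrow> real) \<Rightarrow> 'w measure \<Rightarrow> real \<Rightarrow> (real \<Rightarrow> 'w measure) \<Rightarrow>
   (real \<Rightarrow> 'w \<Rightarrow> real^'n::finite) \<Rightarrow> (real \<Rightarrow> 'e \<Rightarrow> 'e) \<Rightarrow> ('e \<Rightarrow> 'e) \<Rightarrow> ('n \<Rightarrow> 'e \<Rightarrow> 'e) \<Rightarrow>
   'e \<Rightarrow> (real \<Rightarrow> 'w \<Rightarrow> 'e) \<Rightarrow> bool" where
  "cadlag_mild_solution V N M T Filt W S F G x0 X \<longleftrightarrow>
     (\<forall>t\<in>{0..T}. X t \<in> measurable (Filt t) (borel_on V N)) \<and>
     (AE \<omega> in M. cadlag_on V N T (\<lambda>t. X t \<omega>)) \<and>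
     (AE \<omega> in M. X 0 \<omega> = x0) \<and>
     (\<forall>t\<in>{0..T}. \<exists>Z.
        (\<forall>i. has_stochastic_integral V N M Filt (\<lambda>s \<omega>. W s \<omega> $ i) t
               (\<lambda>s \<omega>. S (t - s) (G i (X s \<omega>))) (Z i)) \<and>
        (AE \<omega> in M. \<exists>I.
           has_bochner_integral_on V N (restrict_space lborel {0..t}) (\<lambda>s. S (t - s) (F (X s \<omega>))) I \<and>
           X t \<omega> = S t x0 + I + (\<Sum>i\<in>UNIV. Z i t \<omega>)))"

end

theory Submission
  imports Defs
begin

text \<open>
  A mild solution is described entirely by linear operations, norm limits, Borel measurability and
  the two kinds of integral, and a bounded linear isomorphism \<open>L : V \<rightarrow> V'\<close> respects all of these.
  Let \<open>K\<close> be its inverse. Conjugating the semigroup and the coefficients gives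
  \<open>(L S(t) K) (L x) = L (S(t) x)\<close>, and likewise for \<open>F\<close> and \<open>G\<^sub>i\<close>. Applying \<open>L\<close> to the mild
  equation therefore turns it into the mild equation for \<open>L X\<close>, once \<open>L\<close> has been moved inside
  the integrals. For the Bochner integral and for the stochastic integral this is done on the
  approximants: \<open>L\<close> maps simple functions to simple functions and elementary processes to
  elementary processes, commutes with their (finite) integrals, and the estimate
  \<open>N' (L x) \<le> C * N x\<close> carries every convergence statement from \<open>N\<close> to \<open>N'\<close>
  (\<open>has_bochner_integral_on_L\<close>, \<open>has_stochastic_integral_L\<close>). The generator is transported in the
  same way, as a limit of difference quotients (\<open>generator_conj\<close>).

  All of this is proved once for abstract pairs of spaces, in the locale \<open>normed_iso\<close>, whose
  assumptions are symmetric in \<open>(V, L)\<close> and \<open>(V', K)\<close>. The two halves of the theorem are the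
  instances in which \<open>L\<close> is the inverse of the reconstruction operator and the reconstruction
  operator itself.

  The norm estimate is only available on \<open>V\<close>, so a difference of two elements of \<open>V\<close> must lie in
  \<open>V\<close> before \<open>L\<close> can be estimated there. That the two Besov spaces are linear subspaces is
  deduced from the isomorphism rather than from Minkowski's inequality
  (\<open>bounded_linear_iso_subspaces\<close>).
\<close>

section \<open>The Besov spaces are linear subspaces\<close>

lemma ennpowr_mono:
  assumes "a \<le> b" "0 \<le> s"
  shows "ennpowr a s \<le> ennpowr b s"
proof (cases "b = \<infinity>")
  case True
  then show ?thesis by (simp add: ennpowr_def)
next
  case False
  then have "a \<noteq> \<infinity>" using assms(1) by (auto simp: top_unique)
  moreover have "enn2real a \<le> enn2real b"
    using assms(1) False by (intro enn2real_mono) (auto simp: less_top)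
  ultimately show ?thesis
    using False assms(2) by (auto simp: ennpowr_def intro!: ennreal_leI powr_mono2)
qed

lemma Lp_norm_mono:
  assumes "\<And>x. u x \<le> v x" "0 \<le> p"
  shows "Lp_norm p M u \<le> Lp_norm p M v"
  unfolding Lp_norm_def using assms by (intro ennpowr_mono nn_integral_mono) auto

lemma Lp_norm_zero [simp]: "Lp_norm p M (\<lambda>x. 0) = 0"
  by (simp add: Lp_norm_def ennpowr_def)

lemma besov_enorm_mono:
  assumes "\<And>\<phi>. \<bar>\<xi> \<phi>\<bar> \<le> \<bar>\<zeta> \<phi>\<bar>" "0 \<le> p" "0 \<le> q"
  shows "besov_enorm \<gamma> p q r \<xi> \<le> besov_enorm \<gamma> p q r \<zeta>"
  unfolding besov_enorm_def using assms
  by (intro add_mono Lp_norm_mono SUP_subset_mono order_refl ennreal_leI divide_right_mono) auto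

lemma distributions_half:
  assumes "\<xi> \<in> distributions r"
  shows "(1 / 2) *\<^sub>R \<xi> \<in> distributions r"
proof -
  have bound: "\<exists>C::real. \<forall>\<phi>\<in>Cr_c r. supp \<phi> \<subseteq> K \<longrightarrow> ennreal \<bar>\<xi> \<phi> / 2\<bar> \<le> ennreal C * Cr_norm r \<phi>"
    if "compact K" for K
  proof -
    have "\<exists>C::real. \<forall>\<phi>\<in>Cr_c r. supp \<phi> \<subseteq> K \<longrightarrow> ennreal \<bar>\<xi> \<phi>\<bar> \<le> ennreal C * Cr_norm r \<phi>"
      using assms that by (simp add: distributions_def)
    then obtain C :: real where C: "\<And>\<phi>. \<phi> \<in> Cr_c r \<Longrightarrow> supp \<phi> \<subseteq> K \<Longrightarrow>
        ennreal \<bar>\<xi> \<phi>\<bar> \<le> ennreal C * Cr_norm r \<phi>"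
      by blast
    have half: "ennreal \<bar>\<xi> \<phi> / 2\<bar> \<le> ennreal \<bar>\<xi> \<phi>\<bar>" for \<phi> by (intro ennreal_leI) simp
    show ?thesis
    proof (intro exI ballI impI)
      fix \<phi> assume "\<phi> \<in> Cr_c r" "supp \<phi> \<subseteq> K"
      then show "ennreal \<bar>\<xi> \<phi> / 2\<bar> \<le> ennreal C * Cr_norm r \<phi>"
        using order_trans[OF half C] by blast
    qed
  qed
  have eq: "(1 / 2) *\<^sub>R \<xi> = (\<lambda>\<phi>. \<xi> \<phi> / 2)"
    by (simp add: scaleR_fun_def)
  show ?thesis
    unfolding eq distributions_def
    using assms bound by (auto simp: distributions_def add_divide_distrib)
qed

text \<open>
  Closure under halving is what \<open>bounded_linear_iso_subspaces\<close> asks of the Besov space. For the norm it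
  is mere monotonicity, whereas a direct proof of closure under sums would apply Minkowski's
  inequality to the suprema over test functions and so require their measurability.
\<close>

lemma besov_half:
  assumes "\<xi> \<in> besov \<gamma> p q r" "0 \<le> p" "0 \<le> q"
  shows "(1 / 2) *\<^sub>R \<xi> \<in> besov \<gamma> p q r"
proof -
  have "besov_enorm \<gamma> p q r ((1 / 2) *\<^sub>R \<xi>) \<le> besov_enorm \<gamma> p q r \<xi>"
    using assms by (intro besov_enorm_mono) (auto simp: scaleR_fun_def)
  then show ?thesis
    using assms distributions_half by (auto simp: besov_def intro: le_less_trans)
qed

lemma zero_in_modelled: "(0 :: 'd::finite mfun) \<in> modelled \<gamma> p q"
proof -
  have "comp_norm m (0 :: 'd mpoly) = 0" for m
    by (simp add: comp_norm_def L2_set_def)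
  moreover have "Gam x y (0 :: 'd mpoly) = 0" for x y
    by (simp add: Gam_def mpoly_shift_def)
  ultimately have "mfun_enorm_raw \<gamma> p q (\<lambda>x. 0 :: 'd mpoly) = 0"
    by (simp add: mfun_enorm_raw_def)
  moreover have "(0 :: 'd mfun) = abs_mfun (\<lambda>x. 0)"
    by (simp add: zero_mfun_def)
  ultimately show ?thesis
    unfolding modelled_def by (intro CollectI exI[of _ "\<lambda>x. 0"]) (auto simp: below_def)
qed

text \<open>
  Linearity of \<open>L\<close> and of its inverse says nothing by itself about whether \<open>a x + b y\<close> remains in
  the carrier. But the inverse \<open>K = the_inv_into V L\<close> takes one and the same value \<open>w\<close> at all points
  outside \<open>V'\<close>. If \<open>z = a x + b y\<close> left \<open>V'\<close>, then so would \<open>2 z\<close>, since \<open>V'\<close> is closed under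
  halving, and linearity would give \<open>2 w = w\<close>. Hence \<open>w = a (K x) + b (K y) = 0\<close>, and applying \<open>L\<close>
  yields \<open>z = L 0\<close>, which does lie in \<open>V'\<close>. So \<open>V'\<close> is a subspace, and then \<open>V\<close> is one as the
  image of \<open>V'\<close> under the linear map \<open>K\<close>.
\<close>

lemma bounded_linear_iso_subspaces:
  fixes V :: "'a::real_vector set" and V' :: "'b::real_vector set"
  assumes iso: "bounded_linear_iso V N V' N' L"
    and zero: "0 \<in> V"
    and half: "\<And>z. z \<in> V' \<Longrightarrow> (1 / 2) *\<^sub>R z \<in> V'"
  shows "subspace V" "subspace V'"
proof -
  define K where "K = the_inv_into V L"
  have inj: "inj_on L V" and im: "L ` V = V'"
    using iso by (auto simp: bounded_linear_iso_def bij_betw_def)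
  have linL: "L (a *\<^sub>R x + b *\<^sub>R y) = a *\<^sub>R L x + b *\<^sub>R L y" if "x \<in> V" "y \<in> V" for x y a b
    using iso that by (simp add: bounded_linear_iso_def bounded_linear_map_def)
  have linK: "K (a *\<^sub>R x + b *\<^sub>R y) = a *\<^sub>R K x + b *\<^sub>R K y" if "x \<in> V'" "y \<in> V'" for x y a b
    using iso that by (simp add: bounded_linear_iso_def bounded_linear_map_def K_def)
  have LK: "K y \<in> V" "L (K y) = y" if "y \<in> V'" for y
    using inj im that by (auto simp: K_def the_inv_into_f_f)
  have KL: "K (L x) = x" if "x \<in> V" for x
    using inj that by (simp add: K_def the_inv_into_f_f)
  have outside: "K z = (THE x. False)" if "z \<notin> V'" for z
  proof -
    have "(\<lambda>x. x \<in> V \<and> L x = z) = (\<lambda>x. False)" using im that by auto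
    then show ?thesis by (simp add: K_def the_inv_into_def)
  qed
  have comb': "a *\<^sub>R x + b *\<^sub>R y \<in> V'" if "x \<in> V'" "y \<in> V'" for x y a b
  proof (rule ccontr)
    let ?z = "a *\<^sub>R x + b *\<^sub>R y" and ?w = "a *\<^sub>R K x + b *\<^sub>R K y"
    assume z: "?z \<notin> V'"
    have two: "(2 * a) *\<^sub>R x + (2 * b) *\<^sub>R y \<notin> V'"
      using half z by (force simp: scaleR_add_right)
    have "2 *\<^sub>R ?w = K ((2 * a) *\<^sub>R x + (2 * b) *\<^sub>R y)"
      using that by (simp add: linK scaleR_add_right)
    also have "\<dots> = K ?z" using z two by (simp add: outside)
    also have "\<dots> = ?w" using that by (simp add: linK)
    finally have "?w = 0" by (simp add: scaleR_2)
    then have "?z = L 0" using linL[of "K x" "K y" a b] that by (simp add: LK)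
    then show False using zero im z by auto
  qed
  have comb: "a *\<^sub>R x + b *\<^sub>R y \<in> V" if "x \<in> V" "y \<in> V" for x y a b
  proof -
    have "L x \<in> V'" "L y \<in> V'" using im that by auto
    then have "K (a *\<^sub>R L x + b *\<^sub>R L y) \<in> V" by (intro LK comb')
    with \<open>L x \<in> V'\<close> \<open>L y \<in> V'\<close> that show ?thesis by (simp add: linK KL)
  qed
  show "subspace V"
    using zero comb[of _ _ 1 1] comb[of _ _ _ 0] by (fastforce simp: subspace_def)
  have "L 0 \<in> V'" using zero im by auto
  then have "0 \<in> V'" using comb'[of "L 0" "L 0" 0 0] by simp
  then show "subspace V'"
    using comb'[of _ _ 1 1] comb'[of _ _ _ 0] by (fastforce simp: subspace_def)
qed


section \<open>Measures, integrals and Borel sets\<close>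

lemma space_borel_on: "space (borel_on A n) = A"
  by (simp add: borel_on_def space_measure_of_conv)

lemma measurable_in_V:
  assumes "f \<in> measurable M (borel_on V N)" "x \<in> space M"
  shows "f x \<in> V"
  using measurable_space[OF assms] by (simp add: space_borel_on)

text \<open>
  Here \<open>u\<close> is an arbitrary function: \<open>nn_integral\<close> is then a lower integral, the supremum over the
  simple functions below \<open>u\<close>, and dividing a simple function below \<open>c u\<close> by \<open>c\<close> gives one
  below \<open>u\<close>. This form is needed because in a pair \<open>(V, N)\<close> a function such as
  \<open>y \<mapsto> N (f y - s y)\<close> need not be known to be measurable.
\<close>

lemma nn_integral_cmult_le:
  fixes c :: real
  assumes "c > 0"
  shows "(\<integral>\<^sup>+x. ennreal c * u x \<partial>M) \<le> ennreal c * (\<integral>\<^sup>+x. u x \<partial>M)"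
  unfolding nn_integral_def[of M "\<lambda>x. ennreal c * u x"]
proof (intro SUP_least)
  fix g assume g: "g \<in> {g. simple_function M g \<and> g \<le> (\<lambda>x. ennreal c * u x)}"
  have cc: "ennreal c * (ennreal (1 / c) * a) = a" for a
    using assms by (simp add: mult.assoc[symmetric] ennreal_mult[symmetric])
  have "ennreal (1 / c) * g x \<le> u x" for x
    using mult_left_mono[of "g x" "ennreal c * u x" "ennreal (1 / c)"] g assms
    by (auto simp: le_fun_def mult.assoc[symmetric] ennreal_mult[symmetric])
  then have "(\<integral>\<^sup>+x. ennreal (1 / c) * g x \<partial>M) \<le> (\<integral>\<^sup>+x. u x \<partial>M)"
    by (intro nn_integral_mono)
  moreover have "g \<in> borel_measurable M" using g by (auto intro: borel_measurable_simple_function)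
  ultimately have "ennreal c * (ennreal (1 / c) * (\<integral>\<^sup>+x. g x \<partial>M)) \<le> ennreal c * (\<integral>\<^sup>+x. u x \<partial>M)"
    by (intro mult_left_mono) (auto simp: nn_integral_cmult)
  then show "integral\<^sup>S M g \<le> ennreal c * (\<integral>\<^sup>+x. u x \<partial>M)"
    using g by (simp add: cc nn_integral_eq_simple_integral)
qed

lemma outer_measure_null_mono:
  assumes "(\<lambda>n. outer_measure_of M (A n)) \<longlonglongrightarrow> 0"
    and "\<And>n. B n \<subseteq> A n"
  shows "(\<lambda>n. outer_measure_of M (B n)) \<longlonglongrightarrow> 0"
  by (rule tendsto_sandwich[OF _ _ tendsto_const assms(1)])
    (simp_all add: outer_measure_of_mono assms(2))


section \<open>Isomorphisms of normed spaces\<close>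

text \<open>
  The inverse is a parameter \<open>K\<close> in its own right, which makes the assumptions symmetric: reversing
  the roles of the two spaces gives another instance of the locale (\<open>inverse_iso\<close>).
\<close>

locale normed_iso =
  fixes V :: "'a::real_vector set" and N :: "'a \<Rightarrow> real"
    and V' :: "'b::real_vector set" and N' :: "'b \<Rightarrow> real"
    and L :: "'a \<Rightarrow> 'b" and K :: "'b \<Rightarrow> 'a"
  assumes subsp: "subspace V" and subsp': "subspace V'"
    and N_nonneg: "0 \<le> N x" and N'_nonneg: "0 \<le> N' y"
    and bl: "bounded_linear_map V N V' N' L"
    and bl': "bounded_linear_map V' N' V N K"
    and KL: "x \<in> V \<Longrightarrow> K (L x) = x" and LK: "y \<in> V' \<Longrightarrow> L (K y) = y"
begin

lemma inverse_iso: "normed_iso V' N' V N K L"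
  using subsp subsp' N_nonneg N'_nonneg bl bl' KL LK by unfold_locales

lemma L_in: "x \<in> V \<Longrightarrow> L x \<in> V'"
  and K_in: "y \<in> V' \<Longrightarrow> K y \<in> V"
  using bl bl' by (auto simp: bounded_linear_map_def)

lemma L_comb: "x \<in> V \<Longrightarrow> y \<in> V \<Longrightarrow> L (a *\<^sub>R x + b *\<^sub>R y) = a *\<^sub>R L x + b *\<^sub>R L y"
  using bl by (auto simp: bounded_linear_map_def)

lemma L_add: "x \<in> V \<Longrightarrow> y \<in> V \<Longrightarrow> L (x + y) = L x + L y"
  using L_comb[of x y 1 1] by simp

lemma L_diff: "x \<in> V \<Longrightarrow> y \<in> V \<Longrightarrow> L (x - y) = L x - L y"
  using L_comb[of x y 1 "-1"] by simp

lemma L_scale: "x \<in> V \<Longrightarrow> L (a *\<^sub>R x) = a *\<^sub>R L x"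
  using L_comb[of x x a 0] by simp

lemma L_zero: "L 0 = 0"
  using L_scale[of 0 0] subspace_0[OF subsp] by simp

lemma L_sum: "(\<And>i. i \<in> A \<Longrightarrow> f i \<in> V) \<Longrightarrow> L (sum f A) = (\<Sum>i\<in>A. L (f i))"
  by (induction A rule: infinite_finite_induct)
    (auto simp: L_zero L_add subspace_sum[OF subsp])

lemma L_eq_iff: "x \<in> V \<Longrightarrow> y \<in> V \<Longrightarrow> L x = L y \<longleftrightarrow> x = y"
  by (metis KL)

lemma diff_in: "x \<in> V \<Longrightarrow> y \<in> V \<Longrightarrow> x - y \<in> V"
  by (rule subspace_diff[OF subsp])

lemma norm_bound: obtains C where "C > 0" "\<And>x. x \<in> V \<Longrightarrow> N' (L x) \<le> C * N x"
proof -
  obtain C where C: "\<And>x. x \<in> V \<Longrightarrow> N' (L x) \<le> C * N x"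
    using bl unfolding bounded_linear_map_def by blast
  have "N' (L x) \<le> (\<bar>C\<bar> + 1) * N x" if "x \<in> V" for x
    using C[OF that] mult_right_mono[OF _ N_nonneg, of C "\<bar>C\<bar> + 1" x] by linarith
  then show thesis by (intro that[of "\<bar>C\<bar> + 1"]) auto
qed

text \<open>
  Pointwise limits in a pair \<open>(V, N)\<close> are stated as \<open>N (g h) \<rightarrow> 0\<close>; this is the common step by
  which they pass to the other space. The side condition is only required eventually because
  \<open>g h\<close> lies in \<open>V\<close> only for admissible \<open>h\<close>, such as nonnegative times.
\<close>

lemma null_transfer:
  assumes lim: "((\<lambda>h. N (g h)) \<longlongrightarrow> 0) F"
    and ev: "\<forall>\<^sub>F h in F. g h \<in> V \<and> f h = L (g h)"
  shows "((\<lambda>h. N' (f h)) \<longlongrightarrow> 0) F"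
proof -
  obtain C where C: "C > 0" "\<And>x. x \<in> V \<Longrightarrow> N' (L x) \<le> C * N x" using norm_bound by blast
  have "((\<lambda>h. C * N (g h)) \<longlongrightarrow> 0) F" using tendsto_mult_left[OF lim, of C] by simp
  then show ?thesis
    by (rule Lim_null_comparison[rotated])
      (use ev in eventually_elim, use N'_nonneg C(2) in auto)
qed


section \<open>Measurability and Bochner integrals\<close>

text \<open>\<open>L\<close> is continuous, so preimages of the open sets that generate the Borel sets are open.\<close>

lemma measurable_L: "L \<in> measurable (borel_on V N) (borel_on V' N')"
  unfolding borel_on_def[of V' N']
proof (rule measurable_measure_of)
  show "L \<in> space (borel_on V N) \<rightarrow> V'" by (auto simp: space_borel_on L_in)
next
  fix U assume "U \<in> {U. U \<subseteq> V' \<and> (\<forall>x\<in>U. \<exists>\<epsilon>>0. \<forall>y\<in>V'. N' (y - x) < \<epsilon> \<longrightarrow> y \<in> U)}"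
  then have U: "\<And>x. x \<in> U \<Longrightarrow> \<exists>\<epsilon>>0. \<forall>y\<in>V'. N' (y - x) < \<epsilon> \<longrightarrow> y \<in> U" by auto
  obtain C where C: "C > 0" "\<And>x. x \<in> V \<Longrightarrow> N' (L x) \<le> C * N x" using norm_bound by blast
  have "\<exists>\<epsilon>>0. \<forall>y\<in>V. N (y - x) < \<epsilon> \<longrightarrow> y \<in> L -` U \<inter> V" if x: "x \<in> L -` U \<inter> V" for x
  proof -
    obtain \<epsilon> where e: "\<epsilon> > 0" "\<And>y. y \<in> V' \<Longrightarrow> N' (y - L x) < \<epsilon> \<Longrightarrow> y \<in> U"
      using U[of "L x"] x by auto
    have "L y \<in> U" if "y \<in> V" "N (y - x) < \<epsilon> / C" for y
    proof (rule e(2))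
      have "N' (L y - L x) \<le> C * N (y - x)"
        using C(2)[of "y - x"] x that by (simp add: L_diff diff_in)
      also have "\<dots> < \<epsilon>" using that C(1) by (simp add: field_simps)
      finally show "N' (L y - L x) < \<epsilon>" .
    qed (use that L_in in auto)
    then show ?thesis using e(1) C(1) by (intro exI[of _ "\<epsilon> / C"]) auto
  qed
  then show "L -` U \<inter> space (borel_on V N) \<in> sets (borel_on V N)"
    unfolding space_borel_on unfolding borel_on_def
    by (subst sets_measure_of) (auto intro!: sigma_sets.Basic)
qed auto

lemma measurable_L_comp:
  assumes "f \<in> measurable M (borel_on V N)" "\<And>x. x \<in> space M \<Longrightarrow> g x = L (f x)"
  shows "g \<in> measurable M (borel_on V' N')"
  using measurable_comp[OF assms(1) measurable_L] assms(2)
  by (auto cong: measurable_cong)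

lemma simple_bochner_integrable_L:
  assumes "Bochner_Integration.simple_bochner_integrable M s" "s \<in> space M \<rightarrow> V"
  shows "Bochner_Integration.simple_bochner_integrable M (\<lambda>x. L (s x))"
proof -
  have "{x \<in> space M. L (s x) \<noteq> 0} = {x \<in> space M. s x \<noteq> 0}"
    using assms(2) L_eq_iff[OF _ subspace_0[OF subsp]] by (auto simp: L_zero)
  then show ?thesis
    using assms(1) simple_function_compose1[of M s L]
    by (simp add: Bochner_Integration.simple_bochner_integrable.simps)
qed

text \<open>
  The integral of a simple function is a sum over its values weighted by the measures of its
  level sets. As \<open>L\<close> is injective on \<open>V\<close>, the level sets of \<open>L \<circ> s\<close> are those of \<open>s\<close>, and the two
  sums correspond term by term.
\<close>

lemma simple_bochner_integral_L:
  assumes "s \<in> space M \<rightarrow> V"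
  shows "Bochner_Integration.simple_bochner_integral M s \<in> V"
    and "Bochner_Integration.simple_bochner_integral M (\<lambda>x. L (s x)) =
      L (Bochner_Integration.simple_bochner_integral M s)"
proof -
  let ?m = "\<lambda>y. measure M {x \<in> space M. s x = y}"
  have inV: "s ` space M \<subseteq> V" using assms by auto
  have terms: "?m y *\<^sub>R y \<in> V" if "y \<in> s ` space M" for y
    using that inV by (auto intro: subspace_scale[OF subsp])
  then show "Bochner_Integration.simple_bochner_integral M s \<in> V"
    unfolding simple_bochner_integral_def by (intro subspace_sum[OF subsp])
  have "inj_on L (s ` space M)" using inV by (intro inj_onI) (auto simp: L_eq_iff subset_iff)
  then have "Bochner_Integration.simple_bochner_integral M (\<lambda>x. L (s x)) =
      (\<Sum>y\<in>s ` space M. measure M {x \<in> space M. L (s x) = L y} *\<^sub>R L y)"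
    unfolding simple_bochner_integral_def image_image[symmetric, of L s]
    by (subst sum.reindex) (auto simp: o_def)
  also have "\<dots> = (\<Sum>y\<in>s ` space M. ?m y *\<^sub>R L y)"
  proof (rule sum.cong[OF refl])
    fix y assume "y \<in> s ` space M"
    then have "{x \<in> space M. L (s x) = L y} = {x \<in> space M. s x = y}"
      using inV L_eq_iff by blast
    then show "measure M {x \<in> space M. L (s x) = L y} *\<^sub>R L y = ?m y *\<^sub>R L y" by simp
  qed
  also have "\<dots> = L (Bochner_Integration.simple_bochner_integral M s)"
    unfolding simple_bochner_integral_def
    by (subst L_sum[OF terms]) (use inV in \<open>auto simp: L_scale subset_iff intro!: sum.cong\<close>)
  finally show "Bochner_Integration.simple_bochner_integral M (\<lambda>x. L (s x)) =
      L (Bochner_Integration.simple_bochner_integral M s)" .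
qed

text \<open>
  The images of approximating simple functions are approximating simple functions: the error integral
  grows at most by the factor \<open>C\<close> that bounds \<open>L\<close>.
\<close>

lemma has_bochner_integral_on_L:
  assumes "has_bochner_integral_on V N M f x"
    and fg: "\<And>y. y \<in> space M \<Longrightarrow> g y = L (f y)"
  shows "has_bochner_integral_on V' N' M g (L x)"
proof -
  from assms(1) obtain s where f: "f \<in> measurable M (borel_on V N)" and x: "x \<in> V"
    and s: "\<And>i. Bochner_Integration.simple_bochner_integrable M (s i)" "\<And>i. s i \<in> space M \<rightarrow> V"
    and lim: "(\<lambda>i. \<integral>\<^sup>+y. ennreal (N (f y - s i y)) \<partial>M) \<longlonglongrightarrow> 0"
    and lim': "(\<lambda>i. N (Bochner_Integration.simple_bochner_integral M (s i) - x)) \<longlonglongrightarrow> 0"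
    by (auto simp: has_bochner_integral_on_def)
  obtain C where C: "C > 0" "\<And>x. x \<in> V \<Longrightarrow> N' (L x) \<le> C * N x" using norm_bound by blast
  have bd: "(\<integral>\<^sup>+y. ennreal (N' (g y - L (s i y))) \<partial>M) \<le>
      ennreal C * (\<integral>\<^sup>+y. ennreal (N (f y - s i y)) \<partial>M)" for i
  proof -
    have "ennreal (N' (g y - L (s i y))) \<le> ennreal C * ennreal (N (f y - s i y))"
      if y: "y \<in> space M" for y
    proof -
      have V: "f y \<in> V" "s i y \<in> V" using measurable_in_V[OF f y] s(2)[of i] y by auto
      have "N' (g y - L (s i y)) \<le> C * N (f y - s i y)"
        using C(2)[OF diff_in[OF V]] V by (simp add: fg[OF y] L_diff)
      then show ?thesis
        using C(1) N_nonneg by (simp add: ennreal_mult[symmetric] ennreal_leI)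
    qed
    then have "(\<integral>\<^sup>+y. ennreal (N' (g y - L (s i y))) \<partial>M) \<le>
        (\<integral>\<^sup>+y. ennreal C * ennreal (N (f y - s i y)) \<partial>M)"
      by (intro nn_integral_mono)
    also have "\<dots> \<le> ennreal C * (\<integral>\<^sup>+y. ennreal (N (f y - s i y)) \<partial>M)"
      by (rule nn_integral_cmult_le[OF C(1)])
    finally show ?thesis .
  qed
  have lim_C: "(\<lambda>i. ennreal C * (\<integral>\<^sup>+y. ennreal (N (f y - s i y)) \<partial>M)) \<longlonglongrightarrow> 0"
    using ennreal_tendsto_cmult[OF _ lim, of "ennreal C"] by simp
  show ?thesis
    unfolding has_bochner_integral_on_def
  proof (intro conjI exI[of _ "\<lambda>i y. L (s i y)"] allI)
    show "g \<in> measurable M (borel_on V' N')" by (rule measurable_L_comp[OF f fg])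
    show "L x \<in> V'" by (rule L_in[OF x])
    show "Bochner_Integration.simple_bochner_integrable M (\<lambda>y. L (s i y))" for i
      by (rule simple_bochner_integrable_L[OF s])
    show "(\<lambda>y. L (s i y)) \<in> space M \<rightarrow> V'" for i
      using s(2)[of i] by (auto intro: L_in)
    show "(\<lambda>i. \<integral>\<^sup>+y. ennreal (N' (g y - L (s i y))) \<partial>M) \<longlonglongrightarrow> 0"
      by (rule tendsto_sandwich[OF _ _ tendsto_const lim_C]) (simp_all add: bd)
    show "(\<lambda>i. N' (Bochner_Integration.simple_bochner_integral M (\<lambda>y. L (s i y)) - L x))
        \<longlonglongrightarrow> 0"
      by (rule null_transfer[OF lim'])
        (use simple_bochner_integral_L[OF s(2)] x in \<open>auto simp: L_diff diff_in\<close>)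
  qed
qed


section \<open>Stochastic integrals\<close>

lemma elementary_L:
  assumes "elementary V M Filt t m \<tau> \<xi>"
  shows "elementary V' M Filt t m \<tau> (\<lambda>j \<omega>. L (\<xi> j \<omega>))"
proof -
  have "simple_function (Filt (\<tau> j)) (\<lambda>\<omega>. L (\<xi> j \<omega>))" if "j < m" for j
    using assms that by (intro simple_function_compose1[of _ "\<xi> j" L]) (simp add: elementary_def)
  moreover have "(\<lambda>\<omega>. L (\<xi> j \<omega>)) \<in> space M \<rightarrow> V'" if "j < m" for j
    using assms that unfolding elementary_def by (blast intro: L_in)
  ultimately show ?thesis
    using assms by (simp add: elementary_def)
qed

lemma elem_process_L:
  assumes "elementary V M Filt t m \<tau> \<xi>" "\<omega> \<in> space M"
  shows "elem_process m \<tau> \<xi> s \<omega> \<in> V"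
    and "elem_process m \<tau> (\<lambda>j \<omega>. L (\<xi> j \<omega>)) s \<omega> = L (elem_process m \<tau> \<xi> s \<omega>)"
proof -
  have "\<xi> j \<omega> \<in> V" if "j < m" for j using assms that by (auto simp: elementary_def)
  then have xi: "\<xi> j \<omega> \<in> V" "c *\<^sub>R \<xi> j \<omega> \<in> V" if "j \<in> {..<m}" for j c
    using that by (auto intro: subspace_scale[OF subsp])
  show "elem_process m \<tau> \<xi> s \<omega> \<in> V"
    unfolding elem_process_def by (intro subspace_sum[OF subsp] xi)
  show "elem_process m \<tau> (\<lambda>j \<omega>. L (\<xi> j \<omega>)) s \<omega> = L (elem_process m \<tau> \<xi> s \<omega>)"
    unfolding elem_process_def by (subst L_sum[OF xi(2)]) (simp_all only: L_scale xi cong: sum.cong)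
qed

lemma elem_integral_L:
  assumes "elementary V M Filt t m \<tau> \<xi>" "\<omega> \<in> space M"
  shows "elem_integral w m \<tau> \<xi> u \<omega> \<in> V"
    and "elem_integral w m \<tau> (\<lambda>j \<omega>. L (\<xi> j \<omega>)) u \<omega> = L (elem_integral w m \<tau> \<xi> u \<omega>)"
proof -
  have "\<xi> j \<omega> \<in> V" if "j < m" for j using assms that by (auto simp: elementary_def)
  then have xi: "\<xi> j \<omega> \<in> V" "c *\<^sub>R \<xi> j \<omega> \<in> V" if "j \<in> {..<m}" for j c
    using that by (auto intro: subspace_scale[OF subsp])
  show "elem_integral w m \<tau> \<xi> u \<omega> \<in> V"
    unfolding elem_integral_def by (intro subspace_sum[OF subsp] xi)
  show "elem_integral w m \<tau> (\<lambda>j \<omega>. L (\<xi> j \<omega>)) u \<omega> = L (elem_integral w m \<tau> \<xi> u \<omega>)"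
    unfolding elem_integral_def by (subst L_sum[OF xi(2)]) (simp_all only: L_scale xi cong: sum.cong)
qed

text \<open>
  If \<open>L x\<close> and \<open>L y\<close> are more than \<open>\<epsilon>\<close> apart, then \<open>x\<close> and \<open>y\<close> are more than \<open>\<epsilon> / C\<close> apart, where
  \<open>C\<close> bounds \<open>L\<close>. So the exceptional sets for the transported elementary processes are contained in
  those for the original ones, and both convergences in measure are inherited.
  The transported integrand \<open>\<Psi>\<close> is prescribed only on \<open>[0,t] \<times> \<Omega>\<close>: in the application
  it is built from \<open>K \<circ> L\<close>, which is known to be the identity only on \<open>V\<close>.
\<close>

lemma has_stochastic_integral_L:
  assumes int: "has_stochastic_integral V N M Filt w t \<Phi> Z"
    and sp: "\<And>s. s \<in> {0..t} \<Longrightarrow> space (Filt s) = space M"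
    and \<Psi>: "\<And>s \<omega>. s \<in> {0..t} \<Longrightarrow> \<omega> \<in> space M \<Longrightarrow> \<Psi> s \<omega> = L (\<Phi> s \<omega>)"
  shows "has_stochastic_integral V' N' M Filt w t \<Psi> (\<lambda>u \<omega>. L (Z u \<omega>))"
proof -
  let ?P = "restrict_space lborel {0..t} \<Otimes>\<^sub>M M"
  from int obtain m \<tau> \<xi>
    where meas: "(\<lambda>(s, \<omega>). \<Phi> s \<omega>) \<in> measurable (completion ?P) (borel_on V N)"
    and adapted: "\<And>s. s \<in> {0..t} \<Longrightarrow> \<Phi> s \<in> measurable (Filt s) (borel_on V N)"
    and Z: "\<And>u. u \<in> {0..t} \<Longrightarrow> Z u \<in> measurable M (borel_on V N)"
    and cont: "AE \<omega> in M. \<forall>u\<in>{0..t}. ((\<lambda>v. N (Z v \<omega> - Z u \<omega>)) \<longlongrightarrow> 0) (at u within {0..t})"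
    and el: "\<And>n. elementary V M Filt t (m n) (\<tau> n) (\<xi> n)"
    and conv: "\<And>\<epsilon>. \<epsilon> > 0 \<Longrightarrow> (\<lambda>n. outer_measure_of ?P
           {(s, \<omega>). s \<in> {0..t} \<and> \<omega> \<in> space M \<and>
              N (elem_process (m n) (\<tau> n) (\<xi> n) s \<omega> - \<Phi> s \<omega>) > \<epsilon>}) \<longlonglongrightarrow> 0"
    and conv': "\<And>\<epsilon>. \<epsilon> > 0 \<Longrightarrow> (\<lambda>n. outer_measure_of M
           {\<omega> \<in> space M. \<exists>u\<in>{0..t}.
              N (elem_integral w (m n) (\<tau> n) (\<xi> n) u \<omega> - Z u \<omega>) > \<epsilon>}) \<longlonglongrightarrow> 0"
    unfolding has_stochastic_integral_def by blast
  obtain C where C: "C > 0" "\<And>x. x \<in> V \<Longrightarrow> N' (L x) \<le> C * N x" using norm_bound by blast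
  have big: "N (x - y) > \<epsilon> / C" if "x \<in> V" "y \<in> V" "N' (L x - L y) > \<epsilon>" for x y \<epsilon>
    using C(2)[OF diff_in[OF that(1,2)]] that C(1) by (simp add: L_diff field_simps)
  have \<Phi>V: "\<Phi> s \<omega> \<in> V" if "s \<in> {0..t}" "\<omega> \<in> space M" for s \<omega>
    using measurable_in_V[OF adapted] that sp by auto
  have ZV: "Z u \<omega> \<in> V" if "u \<in> {0..t}" "\<omega> \<in> space M" for u \<omega>
    using measurable_in_V[OF Z] that by auto
  let ?\<xi> = "\<lambda>n j \<omega>. L (\<xi> n j \<omega>)"
  show ?thesis
    unfolding has_stochastic_integral_def
  proof (intro conjI exI[of _ m] exI[of _ \<tau>] exI[of _ ?\<xi>] allI impI ballI)
    show "(\<lambda>(s, \<omega>). \<Psi> s \<omega>) \<in> measurable (completion ?P) (borel_on V' N')"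
      by (rule measurable_L_comp[OF meas])
        (auto simp: space_pair_measure space_restrict_space \<Psi>)
    show "\<Psi> s \<in> measurable (Filt s) (borel_on V' N')" if "s \<in> {0..t}" for s
      using that by (intro measurable_L_comp[OF adapted]) (auto simp: sp \<Psi>)
    show "(\<lambda>\<omega>. L (Z u \<omega>)) \<in> measurable M (borel_on V' N')" if "u \<in> {0..t}" for u
      using that by (intro measurable_L_comp[OF Z]) auto
    show "AE \<omega> in M. \<forall>u\<in>{0..t}.
        ((\<lambda>v. N' (L (Z v \<omega>) - L (Z u \<omega>))) \<longlongrightarrow> 0) (at u within {0..t})"
      using cont AE_space
    proof eventually_elim
      case (elim \<omega>)
      show ?case
      proof
        fix u assume u: "u \<in> {0..t}"
        show "((\<lambda>v. N' (L (Z v \<omega>) - L (Z u \<omega>))) \<longlongrightarrow> 0) (at u within {0..t})"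
          by (rule null_transfer[of "\<lambda>v. Z v \<omega> - Z u \<omega>"])
            (use elim u ZV in \<open>auto simp: L_diff diff_in eventually_at_filter\<close>)
      qed
    qed
    show "elementary V' M Filt t (m n) (\<tau> n) (?\<xi> n)" for n by (rule elementary_L[OF el])
    show "(\<lambda>n. outer_measure_of ?P {(s, \<omega>). s \<in> {0..t} \<and> \<omega> \<in> space M \<and>
        N' (elem_process (m n) (\<tau> n) (?\<xi> n) s \<omega> - \<Psi> s \<omega>) > \<epsilon>}) \<longlonglongrightarrow> 0" if "\<epsilon> > 0" for \<epsilon>
    proof (rule outer_measure_null_mono[OF conv[of "\<epsilon> / C"]])
      show "{(s, \<omega>). s \<in> {0..t} \<and> \<omega> \<in> space M \<and>
          N' (elem_process (m n) (\<tau> n) (?\<xi> n) s \<omega> - \<Psi> s \<omega>) > \<epsilon>} \<subseteq>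
        {(s, \<omega>). s \<in> {0..t} \<and> \<omega> \<in> space M \<and>
          N (elem_process (m n) (\<tau> n) (\<xi> n) s \<omega> - \<Phi> s \<omega>) > \<epsilon> / C}" for n
        using elem_process_L[OF el] \<Phi>V by (auto simp: \<Psi> intro!: big)
    qed (use that C(1) in simp)
    show "(\<lambda>n. outer_measure_of M {\<omega> \<in> space M. \<exists>u\<in>{0..t}.
        N' (elem_integral w (m n) (\<tau> n) (?\<xi> n) u \<omega> - L (Z u \<omega>)) > \<epsilon>}) \<longlonglongrightarrow> 0" if "\<epsilon> > 0" for \<epsilon>
    proof (rule outer_measure_null_mono[OF conv'[of "\<epsilon> / C"]])
      show "{\<omega> \<in> space M. \<exists>u\<in>{0..t}.
          N' (elem_integral w (m n) (\<tau> n) (?\<xi> n) u \<omega> - L (Z u \<omega>)) > \<epsilon>} \<subseteq>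
        {\<omega> \<in> space M. \<exists>u\<in>{0..t}.
          N (elem_integral w (m n) (\<tau> n) (\<xi> n) u \<omega> - Z u \<omega>) > \<epsilon> / C}" for n
        using elem_integral_L[OF el] ZV by (fastforce intro!: big)
    qed (use that C(1) in simp)
  qed
qed


section \<open>Semigroups and mild solutions\<close>

lemma bounded_linear_map_conj:
  assumes "bounded_linear_map V N V N A"
  shows "bounded_linear_map V' N' V' N' (L \<circ> A \<circ> K)"
proof -
  interpret inv: normed_iso V' N' V N K L by (rule inverse_iso)
  have A: "\<And>x. x \<in> V \<Longrightarrow> A x \<in> V"
    and lin: "\<And>x y a b. x \<in> V \<Longrightarrow> y \<in> V \<Longrightarrow> A (a *\<^sub>R x + b *\<^sub>R y) = a *\<^sub>R A x + b *\<^sub>R A y"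
    using assms unfolding bounded_linear_map_def by blast+
  obtain c where c: "\<And>x. x \<in> V \<Longrightarrow> N (A x) \<le> c * N x"
    using assms unfolding bounded_linear_map_def by blast+
  obtain C where C: "C > 0" "\<And>x. x \<in> V \<Longrightarrow> N' (L x) \<le> C * N x" using norm_bound by blast
  obtain C' where C': "C' > 0" "\<And>x. x \<in> V' \<Longrightarrow> N (K x) \<le> C' * N' x" using inv.norm_bound by blast
  have "N' (L (A (K y))) \<le> (C * \<bar>c\<bar> * C') * N' y" if "y \<in> V'" for y
  proof -
    have "N' (L (A (K y))) \<le> C * N (A (K y))" using that by (intro C A K_in)
    also have "\<dots> \<le> C * (\<bar>c\<bar> * N (K y))"
      using c[OF K_in[OF that]] C(1) mult_right_mono[OF abs_ge_self N_nonneg, of c "K y"]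
      by (intro mult_left_mono) auto
    also have "\<dots> \<le> C * (\<bar>c\<bar> * (C' * N' y))"
      using C'(2)[OF that] C(1) by (intro mult_left_mono) auto
    finally show ?thesis by (simp add: mult.assoc)
  qed
  then show ?thesis
    by (auto simp: bounded_linear_map_def L_in A K_in inv.L_comb lin L_comb)
qed

lemma C0_semigroup_conj:
  assumes S: "C0_semigroup V N S"
  shows "C0_semigroup V' N' (\<lambda>t. L \<circ> S t \<circ> K)"
proof -
  have SV: "S t x \<in> V" if "t \<ge> 0" "x \<in> V" for t x
    using S that by (auto simp: C0_semigroup_def bounded_linear_map_def)
  have "((\<lambda>h. N' (L (S h (K y)) - y)) \<longlongrightarrow> 0) (at_right 0)" if "y \<in> V'" for y
  proof (rule null_transfer)
    show "((\<lambda>h. N (S h (K y) - K y)) \<longlongrightarrow> 0) (at_right 0)"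
      using S K_in[OF that] by (auto simp: C0_semigroup_def)
    show "\<forall>\<^sub>F h in at_right 0. S h (K y) - K y \<in> V \<and> L (S h (K y)) - y = L (S h (K y) - K y)"
      using eventually_at_right_less
      by eventually_elim (use that in \<open>auto simp: SV K_in L_diff LK diff_in\<close>)
  qed
  then show ?thesis
    using S by (auto simp: C0_semigroup_def bounded_linear_map_conj SV K_in KL LK)
qed

text \<open>
  The difference quotients of the conjugated semigroup at \<open>L x\<close> are the images of those of \<open>S\<close> at
  \<open>x\<close>. Boundedness of \<open>L\<close> shows that \<open>L\<close> maps the domain into the new domain, boundedness of \<open>K\<close>
  that it maps onto it.
\<close>

lemma generator_conj:
  assumes S: "C0_semigroup V N S" and gen: "generator V N S Dm A"
  shows "generator V' N' (\<lambda>t. L \<circ> S t \<circ> K) (L ` Dm) (L \<circ> A \<circ> K)"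
proof -
  interpret inv: normed_iso V' N' V N K L by (rule inverse_iso)
  have SV: "S t x \<in> V" if "t \<ge> 0" "x \<in> V" for t x
    using S that by (auto simp: C0_semigroup_def bounded_linear_map_def)
  let ?d = "\<lambda>x y h. (1 / h) *\<^sub>R (S h x - x) - y"
  let ?d' = "\<lambda>x y h. (1 / h) *\<^sub>R ((L \<circ> S h \<circ> K) x - x) - y"
  have fwd: "((\<lambda>h. N' (?d' (L x) (L y) h)) \<longlongrightarrow> 0) (at_right 0)"
    if "((\<lambda>h. N (?d x y h)) \<longlongrightarrow> 0) (at_right 0)" "x \<in> V" "y \<in> V" for x y
  proof (rule null_transfer[OF that(1)])
    show "\<forall>\<^sub>F h in at_right 0. ?d x y h \<in> V \<and> ?d' (L x) (L y) h = L (?d x y h)"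
      using eventually_at_right_less
      by eventually_elim
        (use that in \<open>simp add: SV KL L_diff L_scale diff_in subspace_scale[OF subsp]\<close>)
  qed
  have bwd: "((\<lambda>h. N (?d (K x) (K y) h)) \<longlongrightarrow> 0) (at_right 0)"
    if "((\<lambda>h. N' (?d' x y h)) \<longlongrightarrow> 0) (at_right 0)" "x \<in> V'" "y \<in> V'" for x y
  proof (rule inv.null_transfer[OF that(1)])
    show "\<forall>\<^sub>F h in at_right 0. ?d' x y h \<in> V' \<and> ?d (K x) (K y) h = K (?d' x y h)"
      using eventually_at_right_less
      by eventually_elim
        (use that in \<open>simp add: SV KL L_in K_in inv.L_diff inv.L_scale inv.diff_in
            subspace_scale[OF subsp']\<close>)
  qed
  have Dm: "x \<in> Dm \<longleftrightarrow> x \<in> V \<and> (\<exists>y\<in>V. ((\<lambda>h. N (?d x y h)) \<longlongrightarrow> 0) (at_right 0))" for x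
    using gen unfolding generator_def by blast
  have A: "A x \<in> V" "((\<lambda>h. N (?d x (A x) h)) \<longlongrightarrow> 0) (at_right 0)" if "x \<in> Dm" for x
    using gen that unfolding generator_def by blast+
  have "L ` Dm = {x \<in> V'. \<exists>y\<in>V'. ((\<lambda>h. N' (?d' x y h)) \<longlongrightarrow> 0) (at_right 0)}"
  proof (intro set_eqI iffI)
    fix x assume "x \<in> L ` Dm"
    then obtain x0 where "x = L x0" "x0 \<in> Dm" by auto
    then show "x \<in> {x \<in> V'. \<exists>y\<in>V'. ((\<lambda>h. N' (?d' x y h)) \<longlongrightarrow> 0) (at_right 0)}"
      using Dm fwd L_in by blast
  next
    fix x assume "x \<in> {x \<in> V'. \<exists>y\<in>V'. ((\<lambda>h. N' (?d' x y h)) \<longlongrightarrow> 0) (at_right 0)}"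
    then obtain y where x: "x \<in> V'" and y: "y \<in> V'"
      and "((\<lambda>h. N' (?d' x y h)) \<longlongrightarrow> 0) (at_right 0)" by blast
    then have "K x \<in> Dm" using bwd Dm K_in by blast
    then show "x \<in> L ` Dm" using LK[OF x] by (metis imageI)
  qed
  moreover have "(L \<circ> A \<circ> K) x \<in> V' \<and>
      ((\<lambda>h. N' (?d' x ((L \<circ> A \<circ> K) x) h)) \<longlongrightarrow> 0) (at_right 0)" if x: "x \<in> L ` Dm" for x
  proof -
    obtain x0 where x0: "x = L x0" "x0 \<in> Dm" using x by auto
    then have "x0 \<in> V" using Dm by blast
    then have e: "(L \<circ> A \<circ> K) x = L (A x0)" by (simp add: x0 KL)
    show ?thesis
      unfolding e using fwd[OF A(2)[OF x0(2)] \<open>x0 \<in> V\<close> A(1)[OF x0(2)]] A(1)[OF x0(2)] L_in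
      by (simp add: x0(1))
  qed
  ultimately show ?thesis unfolding generator_def by blast
qed

lemma measurable_conj:
  assumes "F \<in> measurable (borel_on V N) (borel_on V N)"
  shows "L \<circ> F \<circ> K \<in> measurable (borel_on V' N') (borel_on V' N')"
proof -
  interpret inv: normed_iso V' N' V N K L by (rule inverse_iso)
  show ?thesis
    using measurable_comp[OF measurable_comp[OF inv.measurable_L assms] measurable_L]
    by (simp add: comp_assoc)
qed

lemma spde_data_conj:
  assumes "spde_data V N S Dm A F G x0"
  shows "spde_data V' N' (\<lambda>t. L \<circ> S t \<circ> K) (L ` Dm) (L \<circ> A \<circ> K)
    (L \<circ> F \<circ> K) (\<lambda>i. L \<circ> G i \<circ> K) (L x0)"
  using assms
  by (auto simp only: spde_data_def C0_semigroup_conj generator_conj measurable_conj L_in)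

lemma cadlag_on_L:
  assumes X: "cadlag_on V N T X" and XV: "\<And>t. t \<in> {0..T} \<Longrightarrow> X t \<in> V"
  shows "cadlag_on V' N' T (\<lambda>t. L (X t))"
  unfolding cadlag_on_def
proof (intro conjI ballI)
  fix t assume t: "t \<in> {0..<T}"
  have "\<forall>\<^sub>F s in at_right t. s \<in> {t<..<T}"
    using t by (intro eventually_at_right_real) auto
  then have "\<forall>\<^sub>F s in at_right t. X s - X t \<in> V \<and> L (X s) - L (X t) = L (X s - X t)"
    by eventually_elim (use t in \<open>auto simp: XV L_diff diff_in\<close>)
  with X t show "((\<lambda>s. N' (L (X s) - L (X t))) \<longlongrightarrow> 0) (at_right t)"
    by (intro null_transfer[of "\<lambda>s. X s - X t"]) (auto simp: cadlag_on_def)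
next
  fix t assume t: "t \<in> {0<..T}"
  then obtain l where l: "l \<in> V" "((\<lambda>s. N (X s - l)) \<longlongrightarrow> 0) (at_left t)"
    using X unfolding cadlag_on_def by blast
  have "\<forall>\<^sub>F s in at_left t. s \<in> {0<..<t}"
    using t by (intro eventually_at_left_real) auto
  then have "\<forall>\<^sub>F s in at_left t. X s - l \<in> V \<and> L (X s) - L l = L (X s - l)"
    by eventually_elim (use t l in \<open>auto simp: XV L_diff diff_in\<close>)
  with l show "\<exists>l\<in>V'. ((\<lambda>s. N' (L (X s) - l)) \<longlongrightarrow> 0) (at_left t)"
    by (intro bexI[of _ "L l"] null_transfer[of "\<lambda>s. X s - l"] L_in)
qed

text \<open>
  At \<open>(s, \<omega>)\<close> the transported integrands are \<open>L (S (t - s) (K (L (F (K (L (X s \<omega>)))))))\<close> and the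
  same with \<open>G i\<close>. Since \<open>X s \<omega>\<close> and its images under \<open>F\<close> and \<open>G i\<close> lie in \<open>V\<close>, the inner
  compositions \<open>K \<circ> L\<close> cancel, and what remains is \<open>L\<close> applied to the original integrand.
\<close>

lemma cadlag_mild_solution_L:
  fixes W :: "real \<Rightarrow> 'w \<Rightarrow> real^'n::finite" and G :: "'n \<Rightarrow> 'a \<Rightarrow> 'a"
  assumes filt: "complete_filtered_prob_space M T Filt"
    and data: "spde_data V N S Dm A F G x0"
    and sol: "cadlag_mild_solution V N M T Filt W S F G x0 X"
  shows "cadlag_mild_solution V' N' M T Filt W (\<lambda>t. L \<circ> S t \<circ> K)
    (L \<circ> F \<circ> K) (\<lambda>i. L \<circ> G i \<circ> K) (L x0) (\<lambda>t \<omega>. L (X t \<omega>))"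
proof -
  have sp: "space (Filt t) = space M" if "t \<in> {0..T}" for t
    using filt that by (auto simp: complete_filtered_prob_space_def subalgebra_def)
  have SV: "S t x \<in> V" if "t \<ge> 0" "x \<in> V" for t x
    using data that by (auto simp: spde_data_def C0_semigroup_def bounded_linear_map_def)
  have FV: "F x \<in> V" and GV: "G i x \<in> V" if "x \<in> V" for x i
    using data that measurable_in_V[of F "borel_on V N" V N] measurable_in_V[of "G i" "borel_on V N" V N]
    by (auto simp: spde_data_def space_borel_on)
  have x0: "x0 \<in> V" using data by (simp add: spde_data_def)
  have X: "X t \<in> measurable (Filt t) (borel_on V N)" if "t \<in> {0..T}" for t
    using sol that by (auto simp: cadlag_mild_solution_def)
  have XV: "X t \<omega> \<in> V" if "t \<in> {0..T}" "\<omega> \<in> space M" for t \<omega>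
    using measurable_in_V[OF X] that sp by auto
  show ?thesis
    unfolding cadlag_mild_solution_def
  proof (intro conjI ballI)
    show "(\<lambda>\<omega>. L (X t \<omega>)) \<in> measurable (Filt t) (borel_on V' N')" if "t \<in> {0..T}" for t
      using that by (intro measurable_L_comp[OF X]) auto
    have "AE \<omega> in M. cadlag_on V N T (\<lambda>t. X t \<omega>)"
      using sol by (auto simp: cadlag_mild_solution_def)
    then show "AE \<omega> in M. cadlag_on V' N' T (\<lambda>t. L (X t \<omega>))"
      using AE_space by eventually_elim (auto intro: cadlag_on_L XV)
    have "AE \<omega> in M. X 0 \<omega> = x0"
      using sol by (auto simp: cadlag_mild_solution_def)
    then show "AE \<omega> in M. L (X 0 \<omega>) = L x0" by eventually_elim simp
  next
    fix t assume t: "t \<in> {0..T}"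
    then obtain Z where
      Z: "\<And>i. has_stochastic_integral V N M Filt (\<lambda>s \<omega>. W s \<omega> $ i) t
               (\<lambda>s \<omega>. S (t - s) (G i (X s \<omega>))) (Z i)"
      and eq: "AE \<omega> in M. \<exists>I.
           has_bochner_integral_on V N (restrict_space lborel {0..t}) (\<lambda>s. S (t - s) (F (X s \<omega>))) I \<and>
           X t \<omega> = S t x0 + I + (\<Sum>i\<in>UNIV. Z i t \<omega>)"
      using sol unfolding cadlag_mild_solution_def by blast
    have ZV: "Z i t \<omega> \<in> V" if "\<omega> \<in> space M" for i \<omega>
      using Z[of i] t that by (auto simp: has_stochastic_integral_def intro: measurable_in_V)
    have "has_stochastic_integral V' N' M Filt (\<lambda>s \<omega>. W s \<omega> $ i) t
        (\<lambda>s \<omega>. (L \<circ> S (t - s) \<circ> K) ((L \<circ> G i \<circ> K) (L (X s \<omega>)))) (\<lambda>u \<omega>. L (Z i u \<omega>))" for i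
      by (rule has_stochastic_integral_L[OF Z])
        (use t in \<open>auto simp: sp KL XV GV SV\<close>)
    moreover have "AE \<omega> in M. \<exists>I.
        has_bochner_integral_on V' N' (restrict_space lborel {0..t})
          (\<lambda>s. (L \<circ> S (t - s) \<circ> K) ((L \<circ> F \<circ> K) (L (X s \<omega>)))) I \<and>
        L (X t \<omega>) = (L \<circ> S t \<circ> K) (L x0) + I + (\<Sum>i\<in>UNIV. L (Z i t \<omega>))"
      using eq AE_space
    proof eventually_elim
      case (elim \<omega>)
      then obtain I where I: "has_bochner_integral_on V N (restrict_space lborel {0..t})
            (\<lambda>s. S (t - s) (F (X s \<omega>))) I"
        and Xt: "X t \<omega> = S t x0 + I + (\<Sum>i\<in>UNIV. Z i t \<omega>)" by blast
      have "I \<in> V" using I by (simp add: has_bochner_integral_on_def)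
      moreover have "S t x0 \<in> V" using t x0 by (auto intro: SV)
      moreover have "(\<Sum>i\<in>UNIV. Z i t \<omega>) \<in> V" using elim ZV by (intro subspace_sum[OF subsp])
      ultimately have "L (X t \<omega>) = (L \<circ> S t \<circ> K) (L x0) + L I + (\<Sum>i\<in>UNIV. L (Z i t \<omega>))"
        using elim ZV x0 by (simp add: Xt L_add L_sum subspace_add[OF subsp] KL)
      moreover have "has_bochner_integral_on V' N' (restrict_space lborel {0..t})
          (\<lambda>s. (L \<circ> S (t - s) \<circ> K) ((L \<circ> F \<circ> K) (L (X s \<omega>)))) (L I)"
        by (rule has_bochner_integral_on_L[OF I])
          (use t elim in \<open>auto simp: space_restrict_space KL XV FV SV\<close>)
      ultimately show ?case by blast
    qed
    ultimately show "\<exists>Z. (\<forall>i. has_stochastic_integral V' N' M Filt (\<lambda>s \<omega>. W s \<omega> $ i) t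
          (\<lambda>s \<omega>. (L \<circ> S (t - s) \<circ> K) ((L \<circ> G i \<circ> K) (L (X s \<omega>)))) (Z i)) \<and>
        (AE \<omega> in M. \<exists>I. has_bochner_integral_on V' N' (restrict_space lborel {0..t})
            (\<lambda>s. (L \<circ> S (t - s) \<circ> K) ((L \<circ> F \<circ> K) (L (X s \<omega>)))) I \<and>
          L (X t \<omega>) = (L \<circ> S t \<circ> K) (L x0) + I + (\<Sum>i\<in>UNIV. Z i t \<omega>))"
      by (intro exI[of _ "\<lambda>i u \<omega>. L (Z i u \<omega>)"]) blast
  qed
qed

end


section \<open>Transport along the reconstruction operator\<close>

theorem theorem4p4:
  fixes \<gamma> p q T :: real and r :: nat
    and M :: "'w measure" and Filt :: "real \<Rightarrow> 'w measure"
    and W :: "real \<Rightarrow> 'w \<Rightarrow> real^'n::finite"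
    and R :: "'d::finite mfun \<Rightarrow> 'd functional"
  defines "B \<equiv> besov \<gamma> p q r" and "NB \<equiv> besov_norm \<gamma> p q r"
    and "D \<equiv> modelled \<gamma> p q" and "ND \<equiv> modelled_norm \<gamma> p q"
    and "Rinv \<equiv> the_inv_into (modelled \<gamma> p q) R"
  assumes "\<gamma> > 0" "\<gamma> \<notin> \<nat>" "p > 1" "q > 1" "real r > \<gamma>" "T > 0"
    and "complete_filtered_prob_space M T Filt"
    and "brownian_motion M T Filt W"
    and "is_reconstruction \<gamma> p q r R"
    and "bounded_linear_iso D ND B NB R"
  shows
    "(\<forall>S dom L F G x0 X.
        spde_data B NB S dom L F G x0 \<longrightarrow>
        cadlag_mild_solution B NB M T Filt W S F G x0 X \<longrightarrow>
          spde_data D ND (\<lambda>t. Rinv \<circ> S t \<circ> R) (Rinv ` dom) (Rinv \<circ> L \<circ> R)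
            (Rinv \<circ> F \<circ> R) (\<lambda>i. Rinv \<circ> G i \<circ> R) (Rinv x0) \<and>
          cadlag_mild_solution D ND M T Filt W (\<lambda>t. Rinv \<circ> S t \<circ> R)
            (Rinv \<circ> F \<circ> R) (\<lambda>i. Rinv \<circ> G i \<circ> R) (Rinv x0) (\<lambda>t \<omega>. Rinv (X t \<omega>))) \<and>
     (\<forall>S dom L F G y0 Y.
        spde_data D ND S dom L F G y0 \<longrightarrow>
        cadlag_mild_solution D ND M T Filt W S F G y0 Y \<longrightarrow>
          spde_data B NB (\<lambda>t. R \<circ> S t \<circ> Rinv) (R ` dom) (R \<circ> L \<circ> Rinv)
            (R \<circ> F \<circ> Rinv) (\<lambda>i. R \<circ> G i \<circ> Rinv) (R y0) \<and>
          cadlag_mild_solution B NB M T Filt W (\<lambda>t. R \<circ> S t \<circ> Rinv)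
            (R \<circ> F \<circ> Rinv) (\<lambda>i. R \<circ> G i \<circ> Rinv) (R y0) (\<lambda>t \<omega>. R (Y t \<omega>)))"
proof -
  have iso: "bounded_linear_iso D ND B NB R" by fact
  have half: "(1 / 2) *\<^sub>R \<xi> \<in> B" if "\<xi> \<in> B" for \<xi>
    using that \<open>p > 1\<close> \<open>q > 1\<close> unfolding B_def by (intro besov_half) auto
  have "0 \<in> D" by (simp add: D_def zero_in_modelled)
  note sub = bounded_linear_iso_subspaces[OF iso this half]
  have inj: "inj_on R D" and im: "R ` D = B"
    using iso by (auto simp: bounded_linear_iso_def bij_betw_def)
  interpret rec: normed_iso D ND B NB R Rinv
  proof
    show "bounded_linear_map D ND B NB R" "bounded_linear_map B NB D ND Rinv"
      using iso by (auto simp: bounded_linear_iso_def Rinv_def D_def)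
    show "Rinv (R f) = f" if "f \<in> D" for f
      using inj that by (simp add: Rinv_def D_def the_inv_into_f_f)
    show "R (Rinv \<xi>) = \<xi>" if "\<xi> \<in> B" for \<xi>
      using inj im that by (auto simp: Rinv_def D_def f_the_inv_into_f)
  qed (use sub in \<open>auto simp: ND_def NB_def modelled_norm_def besov_norm_def\<close>)
  interpret inv: normed_iso B NB D ND Rinv R by (rule rec.inverse_iso)
  show ?thesis
    using \<open>complete_filtered_prob_space M T Filt\<close>
    by (intro conjI allI impI rec.spde_data_conj inv.spde_data_conj
        rec.cadlag_mild_solution_L inv.cadlag_mild_solution_L)
qed

end
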